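(* Let $A$ be a central division algebra over a field $F$ with maximal subfield $M$, and let $\sigma\in G=\mathrm{Aut}_F(M)$ be non-trivial of order $h$. Then there is $c\in\mathrm{Fix}(\sigma)^\times$ such that $A$ contains the cyclic division algebra $$(M/\mathrm{Fix}(\sigma),\sigma,c)=M[t;\sigma]/M[t;\sigma](t^h-c)$$ of degree $h$ over $\mathrm{Fix}(\sigma)$ as an $F$-subalgebra.
   Context: All algebras are unital, associative and finite-dimensional. A central simple algebra $A$ over $F$ has degree $n$ if $\dim_F A=n^2$; a maximal subfield of $A$ is a subfield $M\supseteq F$ of $A$ with $[M:F]=n$. $\mathrm{Fix}(\sigma)$ is the fixed field of $\sigma$ in $M$. $M[t;\sigma]$ is the twisted polynomial ring with $ta=\sigma(a)t$ for $a\in M$; for $c\in\mathrm{Fix}(\sigma)^\times$ the left ideal generated by $t^h-c$ is two-sided and the quotient is the cyclic algebra $(M/\mathrm{Fix}(\sigma),\sigma,c)$. "Contains as an $F$-subalgebra" means contains an $F$-subalgebra isomorphic to it. *)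

theory Defs
  imports "HOL-Algebra.Algebra"
begin

definition ring_center :: "('a, 'b) ring_scheme \<Rightarrow> 'a set"
  where "ring_center R = {z \<in> carrier R. \<forall>a\<in>carrier R. z \<otimes>\<^bsub>R\<^esub> a = a \<otimes>\<^bsub>R\<^esub> z}"

definition skew_field :: "('a, 'b) ring_scheme \<Rightarrow> bool"
  where "skew_field R \<longleftrightarrow>
    ring R \<and> \<one>\<^bsub>R\<^esub> \<noteq> \<zero>\<^bsub>R\<^esub> \<and> Units R = carrier R - {\<zero>\<^bsub>R\<^esub>}"

text \<open>
  Algebras are treated in the embedded style of \<^theory>\<open>HOL-Algebra.Embedded_Algebras\<close>:
  the base field is a subfield of the (not necessarily commutative) ring, here lying in its
  centre, and dimensions refer to left multiplication by scalars.
\<close>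

definition central_division_algebra :: "'a set \<Rightarrow> ('a, 'b) ring_scheme \<Rightarrow> bool"
  where "central_division_algebra K R \<longleftrightarrow>
    skew_field R \<and> subfield K R \<and> ring_center R = K \<and> ring.finite_dimension R K (carrier R)"

definition has_degree :: "'a set \<Rightarrow> ('a, 'b) ring_scheme \<Rightarrow> nat \<Rightarrow> bool"
  where "has_degree K R n \<longleftrightarrow> ring.dimension R (n\<^sup>2) K (carrier R)"

definition maximal_subfield :: "'a set \<Rightarrow> ('a, 'b) ring_scheme \<Rightarrow> 'a set \<Rightarrow> bool"
  where "maximal_subfield K R M \<longleftrightarrow>
    subfield M R \<and> K \<subseteq> M \<and> (\<exists>n. has_degree K R n \<and> ring.dimension R n K M)"

text \<open>
  The group of \<open>K\<close>-algebra automorphisms of \<open>R\<close>. As in \<^theory>\<open>HOL-Algebra.Bij\<close>, its elements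
  are extensional functions, so that an automorphism is determined by its values on the carrier.
\<close>

definition alg_aut_group :: "'a set \<Rightarrow> ('a, 'b) ring_scheme \<Rightarrow> ('a \<Rightarrow> 'a) monoid"
  where "alg_aut_group K R = BijGroup (carrier R)
    \<lparr>carrier := {\<sigma> \<in> Bij (carrier R). \<sigma> \<in> ring_hom R R \<and> (\<forall>a\<in>K. \<sigma> a = a)}\<rparr>"

definition fixed_field :: "('a, 'b) ring_scheme \<Rightarrow> ('a \<Rightarrow> 'a) \<Rightarrow> 'a set"
  where "fixed_field R \<sigma> = {a \<in> carrier R. \<sigma> a = a}"

text \<open>
  Twisted polynomials \<open>R[t;\<sigma>]\<close> are represented by their sequences of (left) coefficients:
  \<open>p\<close> stands for the sum of the \<open>p i t\<^sup>i\<close>. The rule \<open>t a = \<sigma>(a) t\<close> forces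
  \<open>(a t\<^sup>i) (b t\<^sup>j) = a \<sigma>\<^sup>i(b) t\<^bsup>i+j\<^esup>\<close>, whence the product below.
\<close>

definition tw_monom :: "('a, 'b) ring_scheme \<Rightarrow> 'a \<Rightarrow> nat \<Rightarrow> nat \<Rightarrow> 'a"
  where "tw_monom R a n = (\<lambda>i. if i = n then a else \<zero>\<^bsub>R\<^esub>)"

definition twisted_poly_ring :: "('a, 'b) ring_scheme \<Rightarrow> ('a \<Rightarrow> 'a) \<Rightarrow> (nat \<Rightarrow> 'a) ring"
  where "twisted_poly_ring R \<sigma> =
    \<lparr>carrier = up R,
     monoid.mult = (\<lambda>p q n. \<Oplus>\<^bsub>R\<^esub>i\<in>{..n}. p i \<otimes>\<^bsub>R\<^esub> (\<sigma> ^^ i) (q (n - i))),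
     one = tw_monom R \<one>\<^bsub>R\<^esub> 0,
     ring.zero = (\<lambda>i. \<zero>\<^bsub>R\<^esub>),
     ring.add = (\<lambda>p q i. p i \<oplus>\<^bsub>R\<^esub> q i)\<rparr>"

definition cyclic_ideal ::
    "('a, 'b) ring_scheme \<Rightarrow> ('a \<Rightarrow> 'a) \<Rightarrow> nat \<Rightarrow> 'a \<Rightarrow> (nat \<Rightarrow> 'a) set"
  where "cyclic_ideal R \<sigma> h c =
    (let P = twisted_poly_ring R \<sigma>;
         f = (tw_monom R \<one>\<^bsub>R\<^esub> 1) [^]\<^bsub>P\<^esub> h \<ominus>\<^bsub>P\<^esub> tw_monom R c 0
     in {p \<otimes>\<^bsub>P\<^esub> f |p. p \<in> carrier P})"

definition cyclic_algebra ::
    "('a, 'b) ring_scheme \<Rightarrow> ('a \<Rightarrow> 'a) \<Rightarrow> nat \<Rightarrow> 'a \<Rightarrow> (nat \<Rightarrow> 'a) set ring"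
  where "cyclic_algebra R \<sigma> h c = twisted_poly_ring R \<sigma> Quot cyclic_ideal R \<sigma> h c"

text \<open>The canonical map \<open>R \<rightarrow> R[t;\<sigma>]/R[t;\<sigma>](t\<^sup>h - c)\<close>, sending \<open>a\<close> to the class of the constant \<open>a\<close>.\<close>

definition cyclic_const ::
    "('a, 'b) ring_scheme \<Rightarrow> ('a \<Rightarrow> 'a) \<Rightarrow> nat \<Rightarrow> 'a \<Rightarrow> 'a \<Rightarrow> (nat \<Rightarrow> 'a) set"
  where "cyclic_const R \<sigma> h c a =
    cyclic_ideal R \<sigma> h c +>\<^bsub>twisted_poly_ring R \<sigma>\<^esub> tw_monom R a 0"

text \<open>
  \<open>Q\<close>, regarded as a \<open>K\<close>-algebra through the structure map \<open>\<iota>\<close>, is isomorphic as a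
  \<open>K\<close>-algebra to a (unital) \<open>K\<close>-subalgebra of \<open>R\<close>. The library's \<^locale>\<open>subalgebra\<close> is not used,
  as it only asks for an additive subgroup closed under scalar multiplication.
\<close>

definition contains_as_subalgebra ::
    "'a set \<Rightarrow> ('a, 'b) ring_scheme \<Rightarrow> ('a \<Rightarrow> 'q) \<Rightarrow> ('q, 'r) ring_scheme \<Rightarrow> bool"
  where "contains_as_subalgebra K R \<iota> Q \<longleftrightarrow>
    (\<exists>B \<phi>. subring B R \<and> K \<subseteq> B \<and> \<phi> \<in> ring_iso Q (R\<lparr>carrier := B\<rparr>) \<and>
       (\<forall>a\<in>K. \<forall>x\<in>carrier Q. \<phi> (\<iota> a \<otimes>\<^bsub>Q\<^esub> x) = a \<otimes>\<^bsub>R\<^esub> \<phi> x))"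

end

theory Submission
  imports Defs
begin

text \<open>
  By Skolem--Noether there is \<open>u \<noteq> 0\<close> in \<open>A\<close> with \<open>u m = \<sigma>(m) u\<close> for \<open>m \<in> M\<close>. Then \<open>c = u\<^sup>h\<close>
  centralises \<open>M\<close>, hence lies in \<open>M\<close>, and it commutes with \<open>u\<close>, hence is fixed by \<open>\<sigma>\<close>.
  Evaluation \<open>t \<mapsto> u\<close> maps \<open>M[t;\<sigma>]\<close> into \<open>A\<close>; since \<open>1, u, \<dots>, u\<^bsup>h-1\<^esup>\<close> are linearly independent
  over \<open>M\<close> (Dedekind), division by \<open>t\<^sup>h - c\<close> shows that its kernel is generated by \<open>t\<^sup>h - c\<close>.

  Everything rests on one elementary fact: the maps \<open>m \<mapsto> \<Sum>\<^sub>i x\<^sub>i m b\<^sub>i\<close> on a skew field separate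
  elements that are independent over the centre. It shows that \<open>\<sigma>\<close> itself is of this form, which
  yields \<open>u\<close>, and that the dimension of a subfield over the centre is at most the left dimension
  of the skew field over that subfield, which yields both \<open>C\<^sub>A(M) = M\<close> and \<open>[M : Fix(\<sigma>)] \<le> h\<close>.
\<close>

text \<open>Classically these facts come from the double centraliser theorem and the simplicity of
  \<open>A\<close> tensored with its opposite algebra. The maps
  \<open>m \<mapsto> \<Sum> x m b\<close> form the image of that tensor product in the endomorphisms
  of \<open>A\<close>, and separation of independent elements is the part of its structure that
  matters, so no tensor product has to be built. The dimension bound is used in two different skew
  fields. In \<open>A\<close> it controls any field containing \<open>M\<close> and an element
  centralising \<open>M\<close>. In the image \<open>B\<close> of evaluation, whose centre is
  \<open>Fix(\<sigma>)\<close> and which is spanned over \<open>M\<close> by \<open>h\<close> powers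
  of \<open>u\<close>, it bounds \<open>[M : Fix(\<sigma>)]\<close>. The reverse bound is a Dedekind
  argument, so both steps of \<open>Fix(\<sigma>) \<subseteq> M \<subseteq> B\<close> have dimension
  \<open>h\<close>. \<open>B\<close> is a skew field because it is a finite-dimensional subring of
  one; the quotient inherits this through the isomorphism with \<open>B\<close>, and the left ideal
  is two-sided because it is a kernel. Finiteness of the order of \<open>\<sigma>\<close> has to be
  proved before one can divide by \<open>t^h - c\<close>: the group order is \<open>0\<close> for
  elements of infinite order.\<close>

locale skewfield = ring R for R (structure) +
  assumes one_neq_zero: "\<one> \<noteq> \<zero>"
    and Units_eq: "Units R = carrier R - {\<zero>}"

lemma skew_field_iff_skewfield: "skew_field R \<longleftrightarrow> skewfield R"
  unfolding skew_field_def skewfield_def skewfield_axioms_def by auto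

context skewfield
begin

lemma inv_props:
  assumes "x \<in> carrier R" "x \<noteq> \<zero>"
  shows "inv x \<in> carrier R" "inv x \<noteq> \<zero>" "x \<otimes> inv x = \<one>" "inv x \<otimes> x = \<one>"
proof -
  have x: "x \<in> Units R" using assms Units_eq by simp
  show "inv x \<in> carrier R" "x \<otimes> inv x = \<one>" "inv x \<otimes> x = \<one>"
    using x by auto
  show "inv x \<noteq> \<zero>"
    using Units_inv_Units[OF x] Units_eq by simp
qed

lemma no_zero_div:
  assumes "a \<in> carrier R" "b \<in> carrier R" "a \<otimes> b = \<zero>"
  shows "a = \<zero> \<or> b = \<zero>"
proof (rule ccontr)
  assume "\<not> ?thesis"
  then have "a \<noteq> \<zero>" "b \<noteq> \<zero>" by auto
  then have "inv a \<otimes> (a \<otimes> b) = b"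
    using assms inv_props[of a] m_assoc[of "inv a" a b] by simp
  then show False using assms(3) \<open>b \<noteq> \<zero>\<close> \<open>a \<noteq> \<zero>\<close> assms(1) inv_props(1)[of a] by simp
qed

lemma nat_pow_nonzero: "x \<in> carrier R \<Longrightarrow> x \<noteq> \<zero> \<Longrightarrow> x [^] (n::nat) \<noteq> \<zero>"
proof (induction n)
  case (Suc n)
  then show ?case using no_zero_div[of "x [^] n" x] by auto
qed (simp add: one_neq_zero)

end

subsection \<open>Linear systems and sums\<close>

context ring
begin

lemma finsum_remove:
  assumes "finite I" "p \<in> I" "f \<in> I \<rightarrow> carrier R"
  shows "(\<Oplus>i\<in>I. f i) = f p \<oplus> (\<Oplus>i\<in>I - {p}. f i)"
proof -
  have "I = insert p (I - {p})" using assms(2) by blast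
  then have "(\<Oplus>i\<in>I. f i) = (\<Oplus>i\<in>insert p (I - {p}). f i)" by simp
  also have "\<dots> = f p \<oplus> (\<Oplus>i\<in>I - {p}. f i)"
    using assms by (intro finsum_insert) auto
  finally show ?thesis .
qed

lemma finsum_in_subring:
  assumes "subring H R" "f \<in> I \<rightarrow> H"
  shows "(\<Oplus>i\<in>I. f i) \<in> H"
  using assms(2)
proof (induction I rule: infinite_finite_induct)
  case (insert x F)
  have "f \<in> F \<rightarrow> carrier R" "f x \<in> carrier R"
    using insert.prems subringE(1)[OF assms(1)] by auto
  then show ?case using insert subringE(7)[OF assms(1)] by (auto simp: finsum_insert)
qed (use subringE(2)[OF assms(1)] in auto)

lemma finsum_minus:
  assumes "f \<in> I \<rightarrow> carrier R" "g \<in> I \<rightarrow> carrier R"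
  shows "(\<Oplus>i\<in>I. f i \<ominus> g i) = (\<Oplus>i\<in>I. f i) \<ominus> (\<Oplus>i\<in>I. g i)"
  using assms
proof (induction I rule: infinite_finite_induct)
  case (insert x F)
  have c: "f x \<in> carrier R" "g x \<in> carrier R" "finsum R f F \<in> carrier R" "finsum R g F \<in> carrier R"
    "f \<in> F \<rightarrow> carrier R" "g \<in> F \<rightarrow> carrier R"
    using insert.prems by auto
  have s1: "(\<Oplus>i\<in>insert x F. f i \<ominus> g i) = (f x \<ominus> g x) \<oplus> (\<Oplus>i\<in>F. f i \<ominus> g i)"
    using insert c by (intro finsum_insert) auto
  show ?case
    unfolding s1 using insert c
    by (simp add: finsum_insert minus_eq minus_add a_ac)
qed (auto simp: minus_eq)

end

text \<open>Gaussian elimination: a pivot in equation \<open>j\<close> removes one equation and one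
  unknown. The sub-skew-field \<open>H\<close> is a parameter because the solution has to stay
  inside it: \<open>H\<close> is the whole skew field in one application and the field
  \<open>M\<close> in the other, where the solution becomes the coefficients of a Dedekind
  relation.\<close>

lemma (in skewfield) homogeneous_system_nontrivial:
  assumes H: "subring H R" "\<And>x. x \<in> H \<Longrightarrow> x \<noteq> \<zero> \<Longrightarrow> inv x \<in> H"
    and J: "finite J" and I: "finite I" "card J < card I"
    and c: "\<And>i j. i \<in> I \<Longrightarrow> j \<in> J \<Longrightarrow> c i j \<in> H"
  shows "\<exists>a. a \<in> I \<rightarrow> H \<and> (\<exists>i\<in>I. a i \<noteq> \<zero>) \<and> (\<forall>j\<in>J. (\<Oplus>i\<in>I. c i j \<otimes> a i) = \<zero>)"
  using J I c
proof (induction J arbitrary: I c rule: finite_induct)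
  case empty
  then have "I \<noteq> {}" by auto
  then show ?case
    using one_neq_zero subringE(3)[OF H(1)] by (intro exI[of _ "\<lambda>_. \<one>"]) auto
next
  case (insert j J)
  note Hc = subringE(1)[OF H(1)]
  note cH = insert.prems(3)
  show ?case
  proof (cases "\<forall>i\<in>I. c i j = \<zero>")
    case True
    have "\<exists>a. a \<in> I \<rightarrow> H \<and> (\<exists>i\<in>I. a i \<noteq> \<zero>) \<and> (\<forall>j\<in>J. (\<Oplus>i\<in>I. c i j \<otimes> a i) = \<zero>)"
      using insert by (intro insert.IH) auto
    then obtain a where a: "a \<in> I \<rightarrow> H" "\<exists>i\<in>I. a i \<noteq> \<zero>"
        "\<forall>j\<in>J. (\<Oplus>i\<in>I. c i j \<otimes> a i) = \<zero>" by blast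
    have "(\<Oplus>i\<in>I. c i j \<otimes> a i) = \<zero>"
      using a(1) Hc True by (intro add.finprod_one_eqI) auto
    then show ?thesis using a by blast
  next
    case False
    then obtain p where p: "p \<in> I" "c p j \<noteq> \<zero>" by blast
    define d where "d = inv (c p j)"
    have cpj: "c p j \<in> H" using p cH by simp
    have d: "d \<in> H" using H(2)[OF cpj p(2)] by (simp add: d_def)
    have dc: "c p j \<otimes> d = \<one>" using inv_props(3)[of "c p j"] cpj p(2) Hc by (auto simp: d_def)
    define I' where "I' = I - {p}"
    \<comment> \<open>Row \<open>k\<close> minus a multiple of the pivot row \<open>j\<close>. The
      unknowns stand on the right, so rows may only be multiplied from the left.\<close>
    define c' where "c' = (\<lambda>i k. c i k \<ominus> c p k \<otimes> d \<otimes> c i j)"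
    have I': "finite I'" "card J < card I'"
      using insert p by (auto simp: I'_def)
    have c'H: "c' i k \<in> H" if "i \<in> I'" "k \<in> J" for i k
      using that p d cH[of i k] cH[of p k] cH[of i j] subringE(5,6,7)[OF H(1)]
      by (simp add: c'_def I'_def minus_eq)
    have "\<exists>a. a \<in> I' \<rightarrow> H \<and> (\<exists>i\<in>I'. a i \<noteq> \<zero>) \<and> (\<forall>k\<in>J. (\<Oplus>i\<in>I'. c' i k \<otimes> a i) = \<zero>)"
      by (rule insert.IH[OF I']) (rule c'H)
    then obtain a where a: "a \<in> I' \<rightarrow> H" "\<exists>i\<in>I'. a i \<noteq> \<zero>"
        "\<forall>k\<in>J. (\<Oplus>i\<in>I'. c' i k \<otimes> a i) = \<zero>"
      by blast
    define s where "s = (\<Oplus>i\<in>I'. c i j \<otimes> a i)"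
    \<comment> \<open>Back substitution: equation \<open>j\<close> forces this value at the
      pivot.\<close>
    define a' where "a' = a(p := \<ominus> (d \<otimes> s))"
    have aH: "a i \<in> H" if "i \<in> I'" for i using a(1) that by auto
    have cH': "c i k \<in> H" if "i \<in> I'" "k \<in> insert j J" for i k
      using that cH I'_def by auto
    have sH: "s \<in> H"
      unfolding s_def using aH cH' subringE(6)[OF H(1)]
      by (intro finsum_in_subring[OF H(1)]) auto
    have a'H: "a' \<in> I \<rightarrow> H"
      using aH sH d subringE(5,6)[OF H(1)] by (auto simp: a'_def I'_def)
    have split: "(\<Oplus>i\<in>I. c i k \<otimes> a' i) = c p k \<otimes> a' p \<oplus> (\<Oplus>i\<in>I'. c i k \<otimes> a i)"
      if k: "k \<in> insert j J" for k
    proof -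
      have "(\<Oplus>i\<in>I. c i k \<otimes> a' i) = c p k \<otimes> a' p \<oplus> (\<Oplus>i\<in>I'. c i k \<otimes> a' i)"
        unfolding I'_def using k cH Hc a'H p insert.prems(1)
        by (intro finsum_remove) (auto intro!: m_closed)
      also have "(\<Oplus>i\<in>I'. c i k \<otimes> a' i) = (\<Oplus>i\<in>I'. c i k \<otimes> a i)"
        using k cH' Hc aH by (intro finsum_cong') (auto simp: a'_def I'_def intro!: m_closed)
      finally show ?thesis .
    qed
    have zj: "(\<Oplus>i\<in>I. c i j \<otimes> a' i) = \<zero>"
    proof -
      have C: "c p j \<in> carrier R" "d \<in> carrier R" "s \<in> carrier R" using cpj d sH Hc by auto
      have "c p j \<otimes> (d \<otimes> s) = s"
        using dc C by (simp flip: m_assoc)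
      then have "c p j \<otimes> a' p = \<ominus> s"
        using C by (simp add: a'_def r_minus)
      then show ?thesis using split[of j] C l_neg by (simp add: s_def)
    qed
    have zk: "(\<Oplus>i\<in>I. c i k \<otimes> a' i) = \<zero>" if k: "k \<in> J" for k
    proof -
      have cpk: "c p k \<in> carrier R" using k p cH Hc by auto
      have dC: "d \<in> carrier R" "s \<in> carrier R" using d sH Hc by auto
      have aC: "a i \<in> carrier R" if "i \<in> I'" for i using aH that Hc by auto
      have cC: "c i k \<in> carrier R" "c i j \<in> carrier R" if "i \<in> I'" for i
        using cH' that Hc k by auto
      have "\<zero> = (\<Oplus>i\<in>I'. c' i k \<otimes> a i)" using a k by simp
      also have "\<dots> = (\<Oplus>i\<in>I'. c i k \<otimes> a i \<ominus> c p k \<otimes> d \<otimes> (c i j \<otimes> a i))"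
      proof (intro finsum_cong')
        fix i assume i: "i \<in> I'"
        show "c' i k \<otimes> a i = c i k \<otimes> a i \<ominus> c p k \<otimes> d \<otimes> (c i j \<otimes> a i)"
          using cC[OF i] aC[OF i] dC cpk
          by (simp add: c'_def minus_eq l_distr l_minus m_assoc)
      qed (use cC aC dC cpk in auto)
      also have "\<dots> = (\<Oplus>i\<in>I'. c i k \<otimes> a i) \<ominus> (\<Oplus>i\<in>I'. c p k \<otimes> d \<otimes> (c i j \<otimes> a i))"
        using cC aC dC cpk by (intro finsum_minus) auto
      also have "(\<Oplus>i\<in>I'. c p k \<otimes> d \<otimes> (c i j \<otimes> a i)) = c p k \<otimes> d \<otimes> s"
        unfolding s_def using cC aC dC cpk I'(1) by (intro finsum_rdistr[symmetric]) auto
      finally have "(\<Oplus>i\<in>I'. c i k \<otimes> a i) \<ominus> c p k \<otimes> d \<otimes> s = \<zero>" by simp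
      moreover have "c p k \<otimes> a' p = \<ominus> (c p k \<otimes> d \<otimes> s)"
        using cpk dC by (simp add: a'_def r_minus m_assoc)
      moreover have "(\<Oplus>i\<in>I'. c i k \<otimes> a i) \<in> carrier R"
        using cC aC by (intro finsum_closed) auto
      ultimately show ?thesis
        using split[of k] k cpk dC by (simp add: minus_eq a_comm)
    qed
    have "\<exists>i\<in>I. a' i \<noteq> \<zero>"
      using a(2) by (auto simp: a'_def I'_def)
    then show ?thesis using a'H zj zk by blast
  qed
qed

section \<open>Two-sided multiplication maps and density\<close>

text \<open>This is the action of \<open>R\<close> tensored with its opposite ring on
  \<open>R\<close>. Adding one term at a time gives structural induction, so most closure properties
  need no reindexing of sums. Only values on the carrier are constrained, hence a map may be
  replaced by any other that agrees with it there.\<close>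

inductive (in ring) bimult :: "('a \<Rightarrow> 'a) \<Rightarrow> bool" where
  bimult_zero: "(\<And>m. m \<in> carrier R \<Longrightarrow> f m = \<zero>) \<Longrightarrow> bimult f"
| bimult_step: "\<lbrakk>bimult f; x \<in> carrier R; b \<in> carrier R;
    \<And>m. m \<in> carrier R \<Longrightarrow> g m = f m \<oplus> x \<otimes> m \<otimes> b\<rbrakk> \<Longrightarrow> bimult g"

context ring
begin

lemma bimult_closed: "bimult f \<Longrightarrow> m \<in> carrier R \<Longrightarrow> f m \<in> carrier R"
  by (induction rule: bimult.induct) auto

lemma bimult_term:
  assumes "x \<in> carrier R" "b \<in> carrier R"
  shows "bimult (\<lambda>m. x \<otimes> m \<otimes> b)"
  by (rule bimult_step[OF bimult_zero[of "\<lambda>_. \<zero>"] assms]) (use assms in auto)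

lemma bimult_lmult:
  assumes "bimult f" "y \<in> carrier R"
  shows "bimult (\<lambda>m. y \<otimes> f m)"
  using assms
proof (induction rule: bimult.induct)
  case (bimult_step f x b g)
  show ?case
    by (rule bimult.bimult_step[of "\<lambda>m. y \<otimes> f m" "y \<otimes> x" b])
      (use bimult_step bimult_closed in \<open>auto simp: r_distr m_assoc\<close>)
qed (auto intro!: bimult_zero)

lemma bimult_rmult:
  assumes "bimult f" "y \<in> carrier R"
  shows "bimult (\<lambda>m. f m \<otimes> y)"
  using assms
proof (induction rule: bimult.induct)
  case (bimult_step f x b g)
  show ?case
    by (rule bimult.bimult_step[of "\<lambda>m. f m \<otimes> y" x "b \<otimes> y"])
      (use bimult_step bimult_closed in \<open>auto simp: l_distr m_assoc\<close>)
qed (auto intro!: bimult_zero)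

lemma bimult_add:
  assumes "bimult g" "bimult f"
  shows "bimult (\<lambda>m. f m \<oplus> g m)"
  using assms
proof (induction rule: bimult.induct)
  case (bimult_zero g)
  show ?case
    by (rule bimult.bimult_step[of f \<zero> \<zero>]) (use bimult_zero bimult_closed in auto)
next
  case (bimult_step g x b h)
  show ?case
    by (rule bimult.bimult_step[of "\<lambda>m. f m \<oplus> g m" x b])
      (use bimult_step bimult_closed in \<open>auto simp: a_assoc\<close>)
qed

lemma bimult_finsum:
  assumes "finite I" "\<And>i. i \<in> I \<Longrightarrow> bimult (f i)"
  shows "bimult (\<lambda>m. \<Oplus>i\<in>I. f i m)"
  using assms
proof (induction I rule: finite_induct)
  case (insert j I)
  have b: "bimult (\<lambda>m. f j m \<oplus> (\<Oplus>i\<in>I. f i m))"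
    using insert by (intro bimult_add) auto
  moreover have "(\<Oplus>i\<in>insert j I. f i m) = f j m \<oplus> (\<Oplus>i\<in>I. f i m)" if "m \<in> carrier R" for m
    using insert that bimult_closed by (intro finsum_insert) auto
  ultimately show ?case
    using bimult_closed[OF b] by (intro bimult.bimult_step[OF b, of \<zero> \<zero>]) auto
qed (auto intro: bimult_zero)

text \<open>An explicit index set is wanted where the set of terms is itself the induction measure,
  namely when a representation of an automorphism is shortened. Indices in \<open>nat\<close>
  guarantee a fresh one for each new term.\<close>

lemma bimult_representation:
  assumes "bimult f"
  shows "\<exists>I x b. finite (I :: nat set) \<and> x \<in> I \<rightarrow> carrier R \<and> b \<in> I \<rightarrow> carrier R \<and>
    (\<forall>m\<in>carrier R. f m = (\<Oplus>i\<in>I. x i \<otimes> m \<otimes> b i))"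
  using assms
proof (induction rule: bimult.induct)
  case (bimult_zero f)
  then show ?case by (intro exI[of _ "{}"]) auto
next
  case (bimult_step f y c g)
  then obtain I x b where I: "finite (I :: nat set)" "x \<in> I \<rightarrow> carrier R" "b \<in> I \<rightarrow> carrier R"
    "\<forall>m\<in>carrier R. f m = (\<Oplus>i\<in>I. x i \<otimes> m \<otimes> b i)" by blast
  obtain k where k: "k \<notin> I" using ex_new_if_finite[OF infinite_UNIV_nat I(1)] by auto
  let ?x = "x(k := y)" and ?b = "b(k := c)"
  have "g m = (\<Oplus>i\<in>insert k I. ?x i \<otimes> m \<otimes> ?b i)" if m: "m \<in> carrier R" for m
  proof -
    have "(\<Oplus>i\<in>insert k I. ?x i \<otimes> m \<otimes> ?b i) = y \<otimes> m \<otimes> c \<oplus> (\<Oplus>i\<in>I. ?x i \<otimes> m \<otimes> ?b i)"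
      using I k m bimult_step.hyps by (subst finsum_insert) (auto simp: Pi_iff)
    also have "(\<Oplus>i\<in>I. ?x i \<otimes> m \<otimes> ?b i) = (\<Oplus>i\<in>I. x i \<otimes> m \<otimes> b i)"
      using I k m by (intro finsum_cong') (auto simp: Pi_iff)
    finally show ?thesis
      using I m bimult_step.hyps bimult_closed[of f m] by (simp add: a_comm)
  qed
  moreover have "?x \<in> insert k I \<rightarrow> carrier R" "?b \<in> insert k I \<rightarrow> carrier R"
    using I bimult_step.hyps by auto
  ultimately show ?case using I(1) by (intro exI[of _ "insert k I"] exI[of _ ?x] exI[of _ ?b]) auto
qed

lemma Span_finsum_closed:
  assumes "subfield K R" "set Us \<subseteq> carrier R" "f \<in> I \<rightarrow> Span K Us"
  shows "(\<Oplus>i\<in>I. f i) \<in> Span K Us"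
  using assms(3)
proof (induction I rule: infinite_finite_induct)
  case (insert x F)
  have "f \<in> F \<rightarrow> carrier R" "f x \<in> carrier R"
    using insert.prems Span_subgroup_props(1)[OF assms(1,2)] by auto
  then show ?case using insert Span_subgroup_props(3)[OF assms(1,2)] by (auto simp: finsum_insert)
qed (use Span_subgroup_props(2)[OF assms(1,2)] in auto)

end

context skewfield
begin

text \<open>
  Jacobson density for the two-sided multiplications: if every \<open>f\<close> killing \<open>Us\<close> also killed
  \<open>u\<close>, then \<open>f u = (\<Sum>v. f v d\<^sub>v)\<close> for fixed \<open>d\<^sub>v\<close>, which turn out to be central.
\<close>

lemma bimult_separates:
  assumes Z: "subfield (ring_center R) R"
    and "independent (ring_center R) (u # Us)"
  shows "\<exists>f. bimult f \<and> f u = \<one> \<and> (\<forall>v\<in>set Us. f v = \<zero>)"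
  using assms(2)
proof (induction "length Us" arbitrary: u Us rule: less_induct)
  case less
  let ?Z = "ring_center R"
  note ind = less.prems
  have uc: "u \<in> carrier R" and Usc: "set Us \<subseteq> carrier R" and indUs: "independent ?Z Us"
    and uSpan: "u \<notin> Span ?Z Us"
    using independent_backwards[OF ind] independent_in_carrier[OF ind] by auto
  have dist: "distinct Us" using independent_distinct[OF Z indUs] .
  \<comment> \<open>Dual maps for \<open>Us\<close>: the induction hypothesis is applied to
    \<open>v\<close> and the other members of \<open>Us\<close>, a shorter list.\<close>
  have "\<exists>e. bimult e \<and> e v = \<one> \<and> (\<forall>w\<in>set Us - {v}. e w = \<zero>)" if v: "v \<in> set Us" for v
  proof -
    have "independent ?Z (v # remove1 v Us)"
      using v dist length_pos_if_in_set[OF v]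
      by (intro independent_same_set[OF Z _ _ indUs])
        (auto simp: set_remove1_eq length_remove1)
    moreover have "length (remove1 v Us) < length Us"
      using v length_pos_if_in_set[OF v] by (simp add: length_remove1)
    ultimately show ?thesis using less.hyps[of "remove1 v Us" v] dist by (simp add: set_remove1_eq)
  qed
  then obtain e where "\<forall>v\<in>set Us. bimult (e v) \<and> e v v = \<one> \<and> (\<forall>w\<in>set Us - {v}. e v w = \<zero>)"
    using bchoice[of "set Us" "\<lambda>v e. bimult e \<and> e v = \<one> \<and> (\<forall>w\<in>set Us - {v}. e w = \<zero>)"] by blast
  then have e: "bimult (e v)" "e v v = \<one>" "\<And>w. w \<in> set Us - {v} \<Longrightarrow> e v w = \<zero>"
    if "v \<in> set Us" for v using that by auto
  show ?case
  proof (rule ccontr)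
    assume contra: "\<nexists>f. bimult f \<and> f u = \<one> \<and> (\<forall>v\<in>set Us. f v = \<zero>)"
    have kill: "f u = \<zero>" if f: "bimult f" "\<forall>v\<in>set Us. f v = \<zero>" for f
    proof (rule ccontr)
      assume nz: "f u \<noteq> \<zero>"
      have "inv (f u) \<in> carrier R" "inv (f u) \<otimes> f u = \<one>"
        using inv_props[OF bimult_closed[OF f(1) uc] nz] by auto
      moreover have "inv (f u) \<otimes> f v = \<zero>" if "v \<in> set Us" for v
        using f(2) that \<open>inv (f u) \<in> carrier R\<close> by simp
      ultimately have "\<exists>f. bimult f \<and> f u = \<one> \<and> (\<forall>v\<in>set Us. f v = \<zero>)"
        by (intro exI[of _ "\<lambda>m. inv (f u) \<otimes> f m"] conjI bimult_lmult[OF f(1)] ballI)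
      then show False using contra by (rule notE[rotated])
    qed
    define d where "d v = e v u" for v
    have dc: "d v \<in> carrier R" if "v \<in> set Us" for v
      using bimult_closed[OF e(1)[OF that] uc] by (simp add: d_def)
    have key: "f u = (\<Oplus>v\<in>set Us. f v \<otimes> d v)" if f: "bimult f" for f
    proof -
      have fc: "f m \<in> carrier R" if "m \<in> carrier R" for m using bimult_closed[OF f that] .
      have ec: "e v m \<in> carrier R" if "v \<in> set Us" "m \<in> carrier R" for v m
        using bimult_closed[OF e(1)[OF that(1)] that(2)] .
      \<comment> \<open>Subtracting \<open>f v \<otimes> e v m\<close> for every \<open>v\<close>
        corrects \<open>f\<close> so that it kills all of \<open>Us\<close>; by \<open>kill\<close>
        the corrected map kills \<open>u\<close> as well, and this is the claimed formula.\<close>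
      let ?s = "\<lambda>m. \<Oplus>v\<in>set Us. \<ominus> f v \<otimes> e v m"
      have b: "bimult (\<lambda>m. f m \<oplus> ?s m)"
        using f e fc Usc by (intro bimult_add bimult_finsum bimult_lmult) auto
      have "f w \<oplus> ?s w = \<zero>" if w: "w \<in> set Us" for w
      proof -
        have "?s w = (\<Oplus>v\<in>set Us. if w = v then \<ominus> f v else \<zero>)"
          using w fc Usc e by (intro finsum_cong') (auto simp: subset_eq)
        also have "\<dots> = \<ominus> f w"
          using w fc Usc by (intro finsum_singleton) auto
        finally show ?thesis using fc w Usc by (auto simp: r_neg)
      qed
      then have z: "f u \<oplus> ?s u = \<zero>" using kill[OF b] by auto
      have fv: "f v \<in> carrier R" if "v \<in> set Us" for v using that fc Usc by auto
      have sc: "?s u \<in> carrier R" "(\<Oplus>v\<in>set Us. f v \<otimes> d v) \<in> carrier R"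
        using fv ec uc dc by (auto intro!: finsum_closed)
      have "(\<Oplus>v\<in>set Us. f v \<otimes> d v) \<oplus> ?s u = (\<Oplus>v\<in>set Us. f v \<otimes> d v \<oplus> \<ominus> f v \<otimes> e v u)"
        using fv ec uc dc by (intro finsum_addf[symmetric]) auto
      also have "\<dots> = \<zero>"
        using fv dc by (intro add.finprod_one_eqI) (simp add: l_minus r_neg flip: d_def)
      finally have "\<ominus> ?s u = (\<Oplus>v\<in>set Us. f v \<otimes> d v)"
        using sc by (intro minus_equality)
      moreover have "\<ominus> ?s u = f u"
        using sc fc[OF uc] z by (intro minus_equality)
      ultimately show ?thesis by simp
    qed
    \<comment> \<open>Apply \<open>key\<close> to the map \<open>e w\<close> followed by right
      multiplication by \<open>b\<close>. Its value at \<open>u\<close> is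
      \<open>d w \<otimes> b\<close>, while duality leaves only the term
      \<open>b \<otimes> d w\<close> of the sum.\<close>
    have central: "d w \<in> ?Z" if w: "w \<in> set Us" for w
    proof -
      have "d w \<otimes> b = b \<otimes> d w" if b: "b \<in> carrier R" for b
      proof -
        have "d w \<otimes> b = (\<Oplus>v\<in>set Us. e w v \<otimes> b \<otimes> d v)"
          using key[OF bimult_rmult[OF e(1)[OF w] b]] by (simp add: d_def)
        also have "\<dots> = (\<Oplus>v\<in>set Us. if w = v then b \<otimes> d v else \<zero>)"
          using w dc b e by (intro finsum_cong') auto
        also have "\<dots> = b \<otimes> d w"
          using w dc b by (intro finsum_singleton) auto
        finally show ?thesis .
      qed
      then show ?thesis using dc[OF w] by (auto simp: ring_center_def)
    qed
    \<comment> \<open>The identity map in \<open>key\<close> exhibits \<open>u\<close> as a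
      combination of \<open>Us\<close> with central coefficients, against independence.\<close>
    have "u = (\<Oplus>v\<in>set Us. v \<otimes> d v)"
      using key[OF bimult_term[of \<one> \<one>]] uc Usc dc
      by (simp add: subset_eq cong: finsum_cong)
    also have "\<dots> = (\<Oplus>v\<in>set Us. d v \<otimes> v)"
      using central dc Usc by (intro finsum_cong') (auto simp: ring_center_def subset_eq)
    also have "\<dots> \<in> Span ?Z Us"
      using central Span_base_incl[OF Z Usc] Span_smult_closed[OF Z Usc]
      by (intro Span_finsum_closed[OF Z Usc]) auto
    finally show False using uSpan by simp
  qed
qed

text \<open>Independence depends only on the set and the length of the list, so any chosen member
  may be moved to the front before density is applied.\<close>

lemma bimult_dual:
  assumes Z: "subfield (ring_center R) R" and ks: "independent (ring_center R) ks" and v: "v \<in> set ks"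
  shows "\<exists>f. bimult f \<and> f v = \<one> \<and> (\<forall>w\<in>set ks - {v}. f w = \<zero>)"
proof -
  have dist: "distinct ks" using independent_distinct[OF Z ks] .
  have "independent (ring_center R) (v # remove1 v ks)"
    using v dist length_pos_if_in_set[OF v]
    by (intro independent_same_set[OF Z _ _ ks]) (auto simp: length_remove1)
  then show ?thesis using bimult_separates[OF Z, of v "remove1 v ks"] dist by simp
qed

text \<open>
  Otherwise \<open>\<Sum>\<^sub>i k\<^sub>i y a\<^sub>i = 0\<close> has a non-trivial solution \<open>a\<close> valid for all \<open>y \<in> Ys\<close>, hence,
  by \<open>K\<close>-linearity, for all \<open>y\<close>; this contradicts density.
\<close>

lemma independent_length_le_codimension:
  assumes Z: "subfield (ring_center R) R" and K: "subfield K R"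
    and ks: "independent (ring_center R) ks" "set ks \<subseteq> K"
    and Ys: "set Ys \<subseteq> carrier R" "Span K Ys = carrier R"
  shows "length ks \<le> length Ys"
proof (rule ccontr)
  assume neg: "\<not> ?thesis"
  have Kc: "K \<subseteq> carrier R" using subfieldE(3)[OF K] .
  have dist: "distinct ks" using independent_distinct[OF Z ks(1)] .
  have "card (set Ys) < card (set ks)"
    using neg card_length[of Ys] distinct_card[OF dist] by linarith
  moreover have "\<And>k y. k \<in> set ks \<Longrightarrow> y \<in> set Ys \<Longrightarrow> k \<otimes> y \<in> carrier R"
    using ks(2) Ys(1) Kc by auto
  ultimately obtain a where a: "a \<in> set ks \<rightarrow> carrier R" "\<exists>k\<in>set ks. a k \<noteq> \<zero>"
    and sol: "\<forall>y\<in>set Ys. (\<Oplus>k\<in>set ks. k \<otimes> y \<otimes> a k) = \<zero>"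
    using homogeneous_system_nontrivial[OF carrier_is_subring inv_props(1), of "set Ys" "set ks" "\<lambda>k y. k \<otimes> y"]
    by auto
  have kc: "k \<in> carrier R" if "k \<in> set ks" for k using that ks Kc by auto
  have ac: "a k \<in> carrier R" if "k \<in> set ks" for k using that a by auto
  define V where "V = {y \<in> carrier R. (\<Oplus>k\<in>set ks. k \<otimes> y \<otimes> a k) = \<zero>}"
  have "subalgebra K V R"
  proof (intro subalgebra.intro subalgebra_axioms.intro)
    show "subgroup V (add_monoid R)"
    proof (rule add.subgroupI)
      have "\<zero> \<in> V" using kc ac by (auto simp: V_def intro!: add.finprod_one_eqI)
      then show "V \<noteq> {}" by auto
    next
      fix y assume y: "y \<in> V"
      have "(\<Oplus>k\<in>set ks. k \<otimes> \<ominus> y \<otimes> a k) = (\<Oplus>k\<in>set ks. \<zero> \<ominus> k \<otimes> y \<otimes> a k)"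
        using y kc ac by (intro finsum_cong') (auto simp: V_def r_minus l_minus minus_eq)
      also have "\<dots> = (\<Oplus>k\<in>set ks. \<zero>) \<ominus> (\<Oplus>k\<in>set ks. k \<otimes> y \<otimes> a k)"
        using y kc ac by (intro finsum_minus) (auto simp: V_def)
      also have "\<dots> = \<zero>" using y by (simp add: V_def minus_eq)
      finally show "\<ominus> y \<in> V" using y by (simp add: V_def)
    next
      fix y z assume yz: "y \<in> V" "z \<in> V"
      have "(\<Oplus>k\<in>set ks. k \<otimes> (y \<oplus> z) \<otimes> a k) = (\<Oplus>k\<in>set ks. k \<otimes> y \<otimes> a k \<oplus> k \<otimes> z \<otimes> a k)"
        using yz kc ac by (intro finsum_cong') (auto simp: V_def l_distr r_distr)
      also have "\<dots> = (\<Oplus>k\<in>set ks. k \<otimes> y \<otimes> a k) \<oplus> (\<Oplus>k\<in>set ks. k \<otimes> z \<otimes> a k)"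
        using yz kc ac by (intro finsum_addf) (auto simp: V_def)
      finally show "y \<oplus> z \<in> V" using yz by (simp add: V_def)
    qed (auto simp: V_def)
  next
    fix c y assume c: "c \<in> K" and y: "y \<in> V"
    have "k \<otimes> (c \<otimes> y) \<otimes> a k = c \<otimes> (k \<otimes> y \<otimes> a k)" if "k \<in> set ks" for k
    proof -
      have "k \<otimes> c = c \<otimes> k" using that c ks subfieldE(4)[OF K] by auto
      then show ?thesis
        using that c y kc[OF that] ac[OF that] Kc by (auto simp: V_def simp flip: m_assoc)
    qed
    then have "(\<Oplus>k\<in>set ks. k \<otimes> (c \<otimes> y) \<otimes> a k) = (\<Oplus>k\<in>set ks. c \<otimes> (k \<otimes> y \<otimes> a k))"
      using c y kc ac Kc by (intro finsum_cong') (auto simp: V_def subset_eq)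
    also have "\<dots> = c \<otimes> (\<Oplus>k\<in>set ks. k \<otimes> y \<otimes> a k)"
      using c y kc ac Kc by (intro finsum_rdistr[symmetric]) (auto simp: V_def)
    finally show "c \<otimes> y \<in> V" using y c Kc by (auto simp: V_def)
  qed
  moreover have "set Ys \<subseteq> V" using sol Ys by (auto simp: V_def)
  ultimately have "Span K Ys \<subseteq> V" using subalgebra_Span_incl[OF K] by blast
  then have all: "(\<Oplus>k\<in>set ks. k \<otimes> y \<otimes> a k) = \<zero>" if "y \<in> carrier R" for y
    using Ys that by (auto simp: V_def)
  \<comment> \<open>Each term \<open>x \<otimes> k \<otimes> b\<close> of \<open>f k\<close>
    contributes \<open>x\<close> times the relation at \<open>y = b\<close>. So the relation
    survives replacing \<open>k\<close> by \<open>f k\<close>, and the map dual to \<open>p\<close>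
    then isolates \<open>a p\<close>.\<close>
  have bim: "(\<Oplus>k\<in>set ks. f k \<otimes> a k) = \<zero>" if "bimult f" for f
    using that
  proof (induction rule: bimult.induct)
    case (bimult_zero f)
    then show ?case using kc ac by (intro add.finprod_one_eqI) auto
  next
    case (bimult_step f x b g)
    have fc: "f k \<in> carrier R" if "k \<in> set ks" for k
      using bimult_closed[OF bimult_step.hyps(1)] kc that by auto
    have "(\<Oplus>k\<in>set ks. g k \<otimes> a k) = (\<Oplus>k\<in>set ks. f k \<otimes> a k \<oplus> x \<otimes> (k \<otimes> b \<otimes> a k))"
      using kc ac bimult_step.hyps fc by (intro finsum_cong') (auto simp: l_distr m_assoc)
    also have "\<dots> = (\<Oplus>k\<in>set ks. f k \<otimes> a k) \<oplus> (\<Oplus>k\<in>set ks. x \<otimes> (k \<otimes> b \<otimes> a k))"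
      using kc ac bimult_step.hyps fc by (intro finsum_addf) auto
    also have "(\<Oplus>k\<in>set ks. x \<otimes> (k \<otimes> b \<otimes> a k)) = x \<otimes> (\<Oplus>k\<in>set ks. k \<otimes> b \<otimes> a k)"
      using kc ac bimult_step.hyps by (intro finsum_rdistr[symmetric]) auto
    finally show ?case using bimult_step all by simp
  qed
  obtain p where p: "p \<in> set ks" "a p \<noteq> \<zero>" using a by blast
  obtain f where f: "bimult f" "f p = \<one>" "\<forall>v\<in>set ks - {p}. f v = \<zero>"
    using bimult_dual[OF Z ks(1) p(1)] by blast
  have "(\<Oplus>k\<in>set ks. f k \<otimes> a k) = (\<Oplus>k\<in>set ks. if p = k then a k else \<zero>)"
    using p f ac kc by (intro finsum_cong') auto
  also have "\<dots> = a p" using p ac by (intro finsum_singleton) auto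
  finally show False using bim[OF f(1)] p by simp
qed

end

subsection \<open>Subrings and dimensions\<close>

context ring
begin

text \<open>A base over \<open>K\<close> still spans over \<open>L\<close>, though it need not stay
  independent; therefore only finiteness is transferred.\<close>

lemma finite_dimension_over_larger:
  assumes K: "subfield K R" and L: "subfield L R" and KL: "K \<subseteq> L"
    and E: "finite_dimension K E" and EL: "subalgebra L E R"
  shows "finite_dimension L E"
proof -
  obtain n where n: "dimension n K E" using E by blast
  obtain Vs where Vs: "set Vs \<subseteq> carrier R" "Span K Vs = E"
    using exists_base[OF K n] by blast
  have "subalgebra K (Span L Vs) R"
    using Span_is_subalgebra[OF L Vs(1)] KL by (auto simp: subalgebra_def subalgebra_axioms_def)
  then have "E \<subseteq> Span L Vs"
    using subalgebra_Span_incl[OF K] Span_base_incl[OF L Vs(1)] Vs(2) by blast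
  moreover have "Span L Vs \<subseteq> E"
    using subalgebra_Span_incl[OF L EL] Span_base_incl[OF K Vs(1)] Vs(2) by blast
  ultimately show ?thesis using Span_finite_dimension[OF L Vs(1)] by auto
qed

text \<open>Independence and dimension carry the ambient ring as a parameter. With this transfer the
  subring \<open>B\<close> can be treated as a skew field in its own right, with its own
  centre.\<close>

lemma independent_consistent:
  assumes "subring B R" "set Us \<subseteq> B"
  shows "ring.independent (R\<lparr>carrier := B\<rparr>) K Us \<longleftrightarrow> independent K Us"
proof -
  interpret B: ring "R\<lparr>carrier := B\<rparr>" using subring_is_ring[OF assms(1)] .
  have Bc: "B \<subseteq> carrier R" using subringE(1)[OF assms(1)] .
  show ?thesis using assms(2)
  proof (induction Us)
    case (Cons u Us)
    have "B.independent K (u # Us) \<longleftrightarrow> u \<in> B \<and> u \<notin> B.Span K Us \<and> B.independent K Us"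
      using B.independent_backwards[of K u Us] B.li_Cons[of u K Us] by auto
    also have "\<dots> \<longleftrightarrow> u \<in> carrier R \<and> u \<notin> Span K Us \<and> independent K Us"
      using Cons Bc Span_consistent[OF assms(1)] by auto
    also have "\<dots> \<longleftrightarrow> independent K (u # Us)"
      using independent_backwards[of K u Us] li_Cons[of u K Us] by auto
    finally show ?case .
  qed auto
qed

lemma subfield_consistent:
  assumes "subring B R" "K \<subseteq> B" "subfield K R"
  shows "subfield K (R\<lparr>carrier := B\<rparr>)"
  using ring.subfield_iff(1)[OF subring_is_ring[OF assms(1)], of K] assms subfield_iff(2)[of K]
  by simp

lemma dimension_consistent:
  assumes "subring B R" "E \<subseteq> B" "subfield K R" "dimension n K E"
  shows "ring.dimension (R\<lparr>carrier := B\<rparr>) n K E"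
proof -
  interpret B: ring "R\<lparr>carrier := B\<rparr>" using subring_is_ring[OF assms(1)] .
  obtain Vs where Vs: "set Vs \<subseteq> carrier R" "independent K Vs" "length Vs = n" "Span K Vs = E"
    using exists_base[OF assms(3,4)] by blast
  have "set Vs \<subseteq> B" using Span_base_incl[OF assms(3) Vs(1)] Vs(4) assms(2) by auto
  then have "B.independent K Vs" "B.Span K Vs = E"
    using independent_consistent[OF assms(1)] Vs Span_consistent[OF assms(1)] by auto
  then show ?thesis using B.dimension_independent[of K Vs] Vs(3) by simp
qed

lemma combine_map_commuting:
  assumes "set Ks \<subseteq> carrier R" "set Us \<subseteq> carrier R" "x \<in> carrier R"
    "\<And>k. k \<in> set Ks \<Longrightarrow> k \<otimes> x = x \<otimes> k"
  shows "combine Ks (map (\<lambda>u. x \<otimes> u) Us) = x \<otimes> combine Ks Us"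
  using assms
proof (induction Ks Us rule: combine.induct)
  case (1 k Ks u Us)
  then have "k \<otimes> (x \<otimes> u) = x \<otimes> (k \<otimes> u)" by (simp flip: m_assoc)
  then show ?case using 1 by (simp add: r_distr)
qed auto

definition commutant :: "'a set \<Rightarrow> 'a set" where
  "commutant S = {x \<in> carrier R. \<forall>s\<in>S. x \<otimes> s = s \<otimes> x}"

lemma subring_commutant: "S \<subseteq> carrier R \<Longrightarrow> subring (commutant S) R"
proof (rule subringI)
  assume S: "S \<subseteq> carrier R"
  show "commutant S \<subseteq> carrier R" "\<one> \<in> commutant S"
    using S by (auto simp: commutant_def)
  show "\<ominus> h \<in> commutant S" if "h \<in> commutant S" for h
    using that S by (auto simp: commutant_def l_minus r_minus subset_eq)
  fix h k assume hk: "h \<in> commutant S" "k \<in> commutant S"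
  show "h \<oplus> k \<in> commutant S"
    using hk S by (auto simp: commutant_def l_distr r_distr subset_eq)
  have "h \<otimes> k \<otimes> s = s \<otimes> (h \<otimes> k)" if s: "s \<in> S" for s
  proof -
    have c: "h \<in> carrier R" "k \<in> carrier R" "s \<in> carrier R" "h \<otimes> s = s \<otimes> h" "k \<otimes> s = s \<otimes> k"
      using hk s S by (auto simp: commutant_def)
    have "h \<otimes> k \<otimes> s = h \<otimes> s \<otimes> k" using c(1-3) by (simp add: c(5) m_assoc)
    also have "\<dots> = s \<otimes> (h \<otimes> k)" using c(1-3) by (simp add: c(4) m_assoc)
    finally show ?thesis .
  qed
  then show "h \<otimes> k \<in> commutant S" using hk by (auto simp: commutant_def)
qed

end

context skewfield
begin

lemma inv_commute:
  assumes "x \<in> carrier R" "x \<noteq> \<zero>" "s \<in> carrier R" "x \<otimes> s = s \<otimes> x"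
  shows "inv x \<otimes> s = s \<otimes> inv x"
proof -
  note i = inv_props[OF assms(1,2)]
  have "inv x \<otimes> s = inv x \<otimes> (s \<otimes> x) \<otimes> inv x"
    using assms i by (simp add: m_assoc)
  also have "\<dots> = inv x \<otimes> x \<otimes> s \<otimes> inv x"
    using assms i by (simp flip: m_assoc add: assms(4)[symmetric] del: i(4))
  finally show ?thesis using assms i by simp
qed

lemma inv_in_commutant:
  "S \<subseteq> carrier R \<Longrightarrow> x \<in> commutant S \<Longrightarrow> x \<noteq> \<zero> \<Longrightarrow> inv x \<in> commutant S"
  using inv_commute inv_props(1) by (auto simp: commutant_def)

lemma Units_subring:
  assumes "subring B R" "\<And>x. x \<in> B \<Longrightarrow> x \<noteq> \<zero> \<Longrightarrow> inv x \<in> B"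
  shows "Units (R\<lparr>carrier := B\<rparr>) = B - {\<zero>}"
proof (intro equalityI subsetI)
  have Bc: "B \<subseteq> carrier R" using subringE(1)[OF assms(1)] .
  {
    fix x assume "x \<in> Units (R\<lparr>carrier := B\<rparr>)"
    then obtain y where "x \<in> B" "y \<in> B" "x \<otimes> y = \<one>" by (auto simp: Units_def)
    then show "x \<in> B - {\<zero>}" using one_neq_zero Bc by auto
  next
    fix x assume "x \<in> B - {\<zero>}"
    then show "x \<in> Units (R\<lparr>carrier := B\<rparr>)"
      using assms(2)[of x] inv_props(3,4)[of x] Bc by (auto simp: Units_def)
  }
qed

lemma subfieldI_inv:
  assumes "subring K R" "\<And>x y. x \<in> K \<Longrightarrow> y \<in> K \<Longrightarrow> x \<otimes> y = y \<otimes> x"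
    "\<And>x. x \<in> K \<Longrightarrow> x \<noteq> \<zero> \<Longrightarrow> inv x \<in> K"
  shows "subfield K R"
  using subfieldI[OF subcringI[OF assms(1,2)] Units_subring[OF assms(1,3)]] .

lemma inv_in_subfield:
  assumes "subfield K R" "x \<in> K" "x \<noteq> \<zero>"
  shows "inv x \<in> K"
  using subfield_m_inv(1)[OF assms(1), of x] assms by auto

text \<open>A commuting set lies in its commutant, so its bicommutant lies in the commutant too and
  is therefore commutative; commutants are closed under inverses. This produces a field around
  \<open>S\<close> without describing the elements that \<open>S\<close> generates.\<close>

lemma subfield_bicommutant:
  assumes S: "S \<subseteq> carrier R" "\<And>x y. x \<in> S \<Longrightarrow> y \<in> S \<Longrightarrow> x \<otimes> y = y \<otimes> x"
  shows "subfield (commutant (commutant S)) R" "S \<subseteq> commutant (commutant S)"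
proof -
  have C: "commutant S \<subseteq> carrier R" by (auto simp: commutant_def)
  have "S \<subseteq> commutant S" using S by (auto simp: commutant_def)
  then have sub: "commutant (commutant S) \<subseteq> commutant S" by (auto simp: commutant_def)
  show "subfield (commutant (commutant S)) R"
  proof (rule subfieldI_inv[OF subring_commutant[OF C]])
    show "x \<otimes> y = y \<otimes> x" if "x \<in> commutant (commutant S)" "y \<in> commutant (commutant S)" for x y
      using that sub by (auto simp: commutant_def)
  qed (rule inv_in_commutant[OF C])
  show "S \<subseteq> commutant (commutant S)" using S by (auto simp: commutant_def)
qed

text \<open>Left multiplication by \<open>x\<close> is \<open>Z\<close>-linear on \<open>B\<close>
  because \<open>Z\<close> commutes with \<open>B\<close>, and injective because there are no zero
  divisors. It maps a base to a base, so \<open>\<one>\<close> is a multiple of \<open>x\<close>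
  inside \<open>B\<close>.\<close>

lemma inv_in_finite_dimensional_subring:
  assumes B: "subring B R" and Z: "subfield Z R" "\<And>z b. z \<in> Z \<Longrightarrow> b \<in> B \<Longrightarrow> z \<otimes> b = b \<otimes> z"
    and fin: "finite_dimension Z B" and x: "x \<in> B" "x \<noteq> \<zero>"
  shows "inv x \<in> B"
proof -
  have Bc: "B \<subseteq> carrier R" using subringE(1)[OF B] .
  have Zc: "Z \<subseteq> carrier R" using subfieldE(3)[OF Z(1)] .
  have xc: "x \<in> carrier R" using x Bc by auto
  obtain n where n: "dimension n Z B" using fin by blast
  obtain bs where bs: "set bs \<subseteq> carrier R" "independent Z bs" "length bs = n" "Span Z bs = B"
    using exists_base[OF Z(1) n] by blast
  have bsB: "set bs \<subseteq> B" using Span_base_incl[OF Z(1) bs(1)] bs(4) by auto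
  let ?xs = "map (\<lambda>b. x \<otimes> b) bs"
  have comb: "combine Ks ?xs = x \<otimes> combine Ks bs" if "set Ks \<subseteq> Z" for Ks
    using that Z(2)[OF _ x(1)] Zc by (intro combine_map_commuting) (auto simp: bs(1) xc)
  have "independent Z ?xs"
  proof (rule trivial_combine_imp_independent[OF Z(1)])
    show "set ?xs \<subseteq> carrier R" using bs(1) xc by auto
    fix Ks assume Ks: "set Ks \<subseteq> Z" "combine Ks ?xs = \<zero>"
    have "combine Ks bs \<in> carrier R" using Ks(1) Zc bs(1) by auto
    then have "combine Ks bs = \<zero>"
      using no_zero_div[OF xc] comb[OF Ks(1)] Ks(2) x(2) by auto
    then show "set (take (length ?xs) Ks) \<subseteq> {\<zero>}"
      using independent_imp_trivial_combine[OF Z(1) bs(2) Ks(1)] by simp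
  qed
  moreover have "set ?xs \<subseteq> B" using bsB x(1) subringE(6)[OF B] by auto
  ultimately have "Span Z ?xs = B"
    using independent_length_eq_dimension[OF Z(1) n, of ?xs] bs(3) by (simp del: Span.simps)
  then have "\<one> \<in> Span Z ?xs" using subringE(3)[OF B] by simp
  then obtain Ks where Ks: "set Ks \<subseteq> Z" "\<one> = combine Ks ?xs"
    using Span_eq_combine_set[OF Z(1), of ?xs] bs(1) xc by (auto simp del: Span.simps)
  have y: "combine Ks bs \<in> B" using Span_eq_combine_set[OF Z(1) bs(1)] bs(4) Ks(1) by auto
  have yc: "combine Ks bs \<in> carrier R" using y Bc by auto
  have "x \<otimes> combine Ks bs = \<one>" using comb[OF Ks(1)] Ks(2) by simp
  then have "inv x = inv x \<otimes> x \<otimes> combine Ks bs"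
    using inv_props(1)[OF xc x(2)] yc xc by (simp add: m_assoc)
  then have "inv x = combine Ks bs"
    using inv_props(4)[OF xc x(2)] yc by simp
  then show ?thesis using y by simp
qed

text \<open>Let \<open>K\<close> be a field containing \<open>M\<close> and \<open>x\<close>, with
  \<open>d\<close> its dimension over the centre and \<open>r\<close> that of \<open>R\<close> over
  \<open>K\<close>. The tower gives \<open>d * r = n\<^sup>2\<close> and the density bound gives
  \<open>d \<le> r\<close>, so \<open>d \<le> n\<close>. But \<open>K\<close> contains
  \<open>M\<close>, which already has dimension \<open>n\<close>, so the two coincide.\<close>

lemma self_centralizing:
  assumes Z: "subfield (ring_center R) R" and M: "subfield M R" "ring_center R \<subseteq> M"
    and n: "dimension (n\<^sup>2) (ring_center R) (carrier R)" "dimension n (ring_center R) M"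
    and x: "x \<in> commutant M"
  shows "x \<in> M"
proof -
  let ?Z = "ring_center R"
  have Mc: "M \<subseteq> carrier R" using subfieldE(3)[OF M(1)] .
  have xc: "x \<in> carrier R" "\<And>m. m \<in> M \<Longrightarrow> x \<otimes> m = m \<otimes> x" using x by (auto simp: commutant_def)
  define K where "K = commutant (commutant (insert x M))"
  have comm: "a \<otimes> b = b \<otimes> a" if "a \<in> insert x M" "b \<in> insert x M" for a b
    using that xc(2) subfieldE(4)[OF M(1)] by (metis insertE)
  have K: "subfield K R" "insert x M \<subseteq> K"
    using subfield_bicommutant[of "insert x M", OF _ comm] xc(1) Mc unfolding K_def by auto
  have Kc: "K \<subseteq> carrier R" using subfieldE(3)[OF K(1)] .
  have ZK: "?Z \<subseteq> K" using M K by auto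
  have Ksub: "subring K R" using subfieldE(1)[OF K(1)] .
  have finZ: "finite_dimension ?Z (carrier R)" using n(1) finite_dimensionI by blast
  have "subalgebra K K R"
    unfolding subalgebra_def subalgebra_axioms_def
    using subring.axioms(1)[OF Ksub] subringE(6)[OF Ksub] by auto
  then have KZ: "subalgebra ?Z K R" using ZK by (auto simp: subalgebra_def subalgebra_axioms_def)
  have "finite_dimension ?Z K" using subalbegra_incl_imp_finite_dimension[OF Z finZ KZ Kc] .
  then obtain d where d: "dimension d ?Z K" by blast
  have "finite_dimension K (carrier R)"
    using finite_dimension_over_larger[OF Z K(1) ZK finZ carrier_is_subalgebra[OF Kc]] .
  then obtain r where r: "dimension r K (carrier R)" by blast
  have "d * r = n\<^sup>2" using telescopic_base[OF Z K(1) d r] n(1) dimension_is_inj[OF Z] by blast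
  moreover have "d \<le> r"
  proof -
    obtain ks where ks: "set ks \<subseteq> carrier R" "independent ?Z ks" "length ks = d" "Span ?Z ks = K"
      using exists_base[OF Z d] by blast
    obtain Ys where Ys: "set Ys \<subseteq> carrier R" "independent K Ys" "length Ys = r" "Span K Ys = carrier R"
      using exists_base[OF K(1) r] by blast
    have "set ks \<subseteq> K" using Span_base_incl[OF Z ks(1)] ks(4) by auto
    then show ?thesis
      using independent_length_le_codimension[OF Z K(1) ks(2) _ Ys(1,4)] ks(3) Ys(3) by simp
  qed
  ultimately have "d * d \<le> n * n" using mult_le_mono2[of d r d] by (simp add: power2_eq_square)
  then have dn: "d \<le> n" using mult_le_mono[of "Suc n" d "Suc n" d] by (intro leI) (use not_less_eq_eq in fastforce)
  obtain ms where ms: "set ms \<subseteq> carrier R" "independent ?Z ms" "length ms = n" "Span ?Z ms = M"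
    using exists_base[OF Z n(2)] by blast
  have msK: "set ms \<subseteq> K" using Span_base_incl[OF Z ms(1)] ms(4) K(2) by auto
  have "n \<le> d" using independent_length_le_dimension[OF Z d ms(2) msK] ms(3) by simp
  then have "Span ?Z ms = K"
    using independent_length_eq_dimension[OF Z d ms(2) msK] ms(3) dn by simp
  then show ?thesis using ms(4) K(2) by auto
qed

end

subsection \<open>Independence of automorphisms and the Skolem--Noether theorem\<close>

context skewfield
begin

lemma bimult_additive:
  "bimult f \<Longrightarrow> x \<in> carrier R \<Longrightarrow> y \<in> carrier R \<Longrightarrow> f (x \<oplus> y) = f x \<oplus> f y"
proof (induction rule: bimult.induct)
  case (bimult_step f a b g)
  then show ?case using bimult_closed[of f] by (simp add: l_distr r_distr a_ac)
qed auto

lemma bimult_scalar: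
  assumes "bimult f" "z \<in> ring_center R" "x \<in> carrier R"
  shows "f (z \<otimes> x) = z \<otimes> f x"
  using assms
proof (induction rule: bimult.induct)
  case (bimult_step f a b g)
  have "z \<in> carrier R" "a \<otimes> z = z \<otimes> a" using bimult_step by (auto simp: ring_center_def)
  moreover have "a \<otimes> (z \<otimes> y) = z \<otimes> (a \<otimes> y)" if "y \<in> carrier R" for y
    using calculation bimult_step that by (simp flip: m_assoc)
  ultimately show ?case using bimult_step bimult_closed[of f x] by (simp add: r_distr m_assoc)
qed (auto simp: ring_center_def)

text \<open>If the maps \<open>e v\<close> are dual to a base of \<open>M\<close>, then
  \<open>\<Sum> s(v) e v\<close> agrees with \<open>s\<close> on that base, hence on
  \<open>M\<close> by linearity over the centre.\<close>

lemma linear_map_is_bimult: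
  assumes Z: "subfield (ring_center R) R" and M: "dimension n (ring_center R) M"
    and s: "\<And>x. x \<in> M \<Longrightarrow> s x \<in> carrier R"
      "\<And>x y. x \<in> M \<Longrightarrow> y \<in> M \<Longrightarrow> s (x \<oplus> y) = s x \<oplus> s y"
      "\<And>z x. z \<in> ring_center R \<Longrightarrow> x \<in> M \<Longrightarrow> s (z \<otimes> x) = z \<otimes> s x"
  shows "\<exists>f. bimult f \<and> (\<forall>m\<in>M. f m = s m)"
proof -
  let ?Z = "ring_center R"
  obtain ms where ms: "set ms \<subseteq> carrier R" "independent ?Z ms" "Span ?Z ms = M"
    using exists_base[OF Z M] by blast
  have msM: "set ms \<subseteq> M" using Span_base_incl[OF Z ms(1)] ms(3) by auto
  have "\<forall>v\<in>set ms. \<exists>e. bimult e \<and> e v = \<one> \<and> (\<forall>w\<in>set ms - {v}. e w = \<zero>)"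
    using bimult_dual[OF Z ms(2)] by blast
  then obtain e where "\<forall>v\<in>set ms. bimult (e v) \<and> e v v = \<one> \<and> (\<forall>w\<in>set ms - {v}. e v w = \<zero>)"
    using bchoice[of "set ms" "\<lambda>v e. bimult e \<and> e v = \<one> \<and> (\<forall>w\<in>set ms - {v}. e w = \<zero>)"] by blast
  then have e: "bimult (e v)" "e v v = \<one>" "\<And>w. w \<in> set ms - {v} \<Longrightarrow> e v w = \<zero>"
    if "v \<in> set ms" for v using that by auto
  define f where "f = (\<lambda>m. \<Oplus>v\<in>set ms. s v \<otimes> e v m)"
  have f: "bimult f"
    unfolding f_def using e s(1) msM by (intro bimult_finsum bimult_lmult) auto
  have fv: "f w = s w" if w: "w \<in> set ms" for w
  proof -
    have "f w = (\<Oplus>v\<in>set ms. if w = v then s v else \<zero>)"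
      unfolding f_def using w e s(1) msM by (intro finsum_cong') auto
    also have "\<dots> = s w" using w s(1) msM by (intro finsum_singleton) auto
    finally show ?thesis .
  qed
  have Msub: "subalgebra ?Z M R"
    using finite_dimension_imp_subalgebra[OF Z finite_dimensionI[OF M]] .
  have Mc: "M \<subseteq> carrier R" using space_subgroup_props(1)[OF Z M] .
  have s0: "s \<zero> = \<zero>"
    using s(3)[of \<zero> \<zero>] s(1)[of \<zero>] space_subgroup_props(2)[OF Z M] subfieldE(1)[OF Z] subringE(2) by fastforce
  define V where "V = {m \<in> M. f m = s m}"
  have fc: "f m \<in> carrier R" if "m \<in> M" for m using bimult_closed[OF f] that Mc by auto
  have Zsub: "subring ?Z R" using subfieldE(1)[OF Z] .
  \<comment> \<open>Negation is multiplication by this central scalar, so \<open>smV\<close> also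
    yields closure of \<open>V\<close> under negatives.\<close>
  have m1: "\<ominus> \<one> \<in> ?Z" using subringE(3,5)[OF Zsub] by auto
  have smV: "z \<otimes> m \<in> V" if "z \<in> ?Z" "m \<in> V" for z m
    using that bimult_scalar[OF f that(1)] s(3)[OF that(1)] Mc subalgebra.smult_closed[OF Msub that(1)]
    by (auto simp: V_def)
  have "subalgebra ?Z V R"
  proof (intro subalgebra.intro subalgebra_axioms.intro)
    show "subgroup V (add_monoid R)"
    proof (rule add.subgroupI)
      show "V \<subseteq> carrier R" using Mc by (auto simp: V_def)
      have "f \<zero> = \<zero>" using bimult_additive[OF f, of \<zero> \<zero>] bimult_closed[OF f, of \<zero>] by simp
      then have "\<zero> \<in> V" using s0 space_subgroup_props(2)[OF Z M] by (auto simp: V_def)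
      then show "V \<noteq> {}" by auto
      show "\<ominus> a \<in> V" if "a \<in> V" for a
        using smV[OF m1 that] \<open>V \<subseteq> carrier R\<close> that by (auto simp: l_minus)
      show "a \<oplus> b \<in> V" if "a \<in> V" "b \<in> V" for a b
        using that bimult_additive[OF f, of a b] s(2)[of a b] Mc space_subgroup_props(3)[OF Z M]
        by (auto simp: V_def)
    qed
  qed (rule smV)
  moreover have "set ms \<subseteq> V" using fv msM by (auto simp: V_def)
  ultimately have "M \<subseteq> V" using subalgebra_Span_incl[OF Z] ms(3) by blast
  then show ?thesis using f by (intro exI[of _ f]) (auto simp: V_def)
qed

text \<open>
  If the maps \<open>x\<^sub>i m\<close> are linearly independent over \<open>R\<close>, comparing \<open>s(mm') = s(m) s(m')\<close> termwise
  shows that every \<open>b\<^sub>i\<close> intertwines; otherwise the representation of \<open>s\<close> can be shortened.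
\<close>

lemma intertwiner_from_representation:
  assumes M: "subring M R"
    and s: "\<And>x. x \<in> M \<Longrightarrow> s x \<in> carrier R" "s \<one> = \<one>"
      "\<And>x y. x \<in> M \<Longrightarrow> y \<in> M \<Longrightarrow> s (x \<otimes> y) = s x \<otimes> s y"
    and I: "finite I" "x \<in> I \<rightarrow> carrier R" "b \<in> I \<rightarrow> carrier R"
    and rep: "\<And>m. m \<in> M \<Longrightarrow> s m = (\<Oplus>i\<in>I. x i \<otimes> m \<otimes> b i)"
  shows "\<exists>u\<in>carrier R - {\<zero>}. \<forall>m\<in>M. m \<otimes> u = u \<otimes> s m"
  using I rep
proof (induction I arbitrary: b rule: finite_psubset_induct)
  case (psubset I)
  have Mc: "M \<subseteq> carrier R" using subringE(1)[OF M] .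
  have xc: "x i \<in> carrier R" if "i \<in> I" for i using psubset.prems that by auto
  have bc: "b i \<in> carrier R" if "i \<in> I" for i using psubset.prems that by auto
  show ?case
  proof (cases "\<exists>c. c \<in> I \<rightarrow> carrier R \<and> (\<exists>i\<in>I. c i \<noteq> \<zero>) \<and> (\<forall>m\<in>M. (\<Oplus>i\<in>I. x i \<otimes> m \<otimes> c i) = \<zero>)")
    case True
    then obtain c j where c: "c \<in> I \<rightarrow> carrier R" "\<forall>m\<in>M. (\<Oplus>i\<in>I. x i \<otimes> m \<otimes> c i) = \<zero>"
      and j: "j \<in> I" "c j \<noteq> \<zero>" by blast
    have cc: "c i \<in> carrier R" if "i \<in> I" for i using c that by auto
    \<comment> \<open>With this factor \<open>b' j\<close> vanishes, and subtracting the relation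
      times \<open>d\<close> on the right does not change the represented map; one index is
      saved.\<close>
    define d where "d = inv (c j) \<otimes> b j"
    note ij = inv_props[OF cc[OF j(1)] j(2)]
    have d: "d \<in> carrier R" "c j \<otimes> d = b j"
      using ij bc[OF j(1)] cc[OF j(1)] by (auto simp: d_def simp flip: m_assoc)
    define b' where "b' = (\<lambda>i. b i \<ominus> c i \<otimes> d)"
    have b': "b' i \<in> carrier R" if "i \<in> I" for i using that bc cc d by (auto simp: b'_def)
    have "s m = (\<Oplus>i\<in>I - {j}. x i \<otimes> m \<otimes> b' i)" if m: "m \<in> M" for m
    proof -
      have mc: "m \<in> carrier R" using m Mc by auto
      have b'j: "b' j = \<zero>" using d bc[OF j(1)] by (simp add: b'_def minus_eq r_neg)
      have "(\<Oplus>i\<in>I. x i \<otimes> m \<otimes> b' i) = (\<Oplus>i\<in>I. x i \<otimes> m \<otimes> b i \<ominus> x i \<otimes> m \<otimes> c i \<otimes> d)"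
        using xc bc cc d mc
        by (intro finsum_cong') (auto simp: b'_def minus_eq r_distr r_minus m_assoc)
      also have "\<dots> = s m \<ominus> (\<Oplus>i\<in>I. x i \<otimes> m \<otimes> c i \<otimes> d)"
        using xc bc cc d mc psubset.prems(3)[OF m] by (subst finsum_minus) auto
      also have "(\<Oplus>i\<in>I. x i \<otimes> m \<otimes> c i \<otimes> d) = (\<Oplus>i\<in>I. x i \<otimes> m \<otimes> c i) \<otimes> d"
        using xc cc d mc psubset.hyps by (intro finsum_ldistr[symmetric]) auto
      also have "\<dots> = \<zero>" using c m d by simp
      finally have "s m = (\<Oplus>i\<in>I. x i \<otimes> m \<otimes> b' i)" using s(1)[OF m] by (simp add: minus_eq)
      also have "\<dots> = x j \<otimes> m \<otimes> b' j \<oplus> (\<Oplus>i\<in>I - {j}. x i \<otimes> m \<otimes> b' i)"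
        using xc b' mc psubset.hyps j by (intro finsum_remove) auto
      also have "\<dots> = (\<Oplus>i\<in>I - {j}. x i \<otimes> m \<otimes> b' i)"
        using xc b' mc j b'j by (simp add: Pi_iff)
      finally show ?thesis .
    qed
    then show ?thesis
      using j psubset.prems(1) b' by (intro psubset.IH[of "I - {j}" b']) auto
  next
    case False
    have inter: "m' \<otimes> b i = b i \<otimes> s m'" if m': "m' \<in> M" and i: "i \<in> I" for m' i
    proof -
      have m'c: "m' \<in> carrier R" "s m' \<in> carrier R" using m' Mc s by auto
      define c where "c = (\<lambda>i. m' \<otimes> b i \<ominus> b i \<otimes> s m')"
      have cc: "c \<in> I \<rightarrow> carrier R" using bc m'c by (auto simp: c_def)
      have "(\<Oplus>i\<in>I. x i \<otimes> m \<otimes> c i) = \<zero>" if m: "m \<in> M" for m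
      proof -
        have mc: "m \<in> carrier R" using m Mc by auto
        have "(\<Oplus>i\<in>I. x i \<otimes> m \<otimes> c i) = (\<Oplus>i\<in>I. x i \<otimes> (m \<otimes> m') \<otimes> b i \<ominus> x i \<otimes> m \<otimes> b i \<otimes> s m')"
          using xc bc m'c mc
          by (intro finsum_cong') (auto simp: c_def minus_eq r_distr r_minus m_assoc)
        also have "\<dots> = (\<Oplus>i\<in>I. x i \<otimes> (m \<otimes> m') \<otimes> b i) \<ominus> (\<Oplus>i\<in>I. x i \<otimes> m \<otimes> b i \<otimes> s m')"
          using xc bc m'c mc by (intro finsum_minus) auto
        also have "(\<Oplus>i\<in>I. x i \<otimes> m \<otimes> b i \<otimes> s m') = (\<Oplus>i\<in>I. x i \<otimes> m \<otimes> b i) \<otimes> s m'"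
          using xc bc m'c mc psubset.hyps by (intro finsum_ldistr[symmetric]) auto
        also have "\<dots> = s (m \<otimes> m')" using psubset.prems(3)[OF m] s(3)[OF m m'] by simp
        also have "(\<Oplus>i\<in>I. x i \<otimes> (m \<otimes> m') \<otimes> b i) = s (m \<otimes> m')"
          using psubset.prems(3)[of "m \<otimes> m'"] subringE(6)[OF M m m'] by simp
        finally show ?thesis using s(1)[OF subringE(6)[OF M m m']] by (simp add: minus_eq r_neg)
      qed
      then have "c i = \<zero>" using False cc i by blast
      then show ?thesis using m'c bc[OF i] by (simp add: c_def minus_eq) (metis a_inv_closed m_closed minus_equality minus_minus)
    qed
    have "\<exists>i\<in>I. b i \<noteq> \<zero>"
    proof (rule ccontr)
      assume "\<not> ?thesis"
      then have "(\<Oplus>i\<in>I. x i \<otimes> \<one> \<otimes> b i) = \<zero>"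
        using xc by (intro add.finprod_one_eqI) auto
      then show False using psubset.prems(3)[OF subringE(3)[OF M]] s(2) one_neq_zero by simp
    qed
    then show ?thesis using inter bc by blast
  qed
qed

text \<open>The coefficients of a representation that stand on the right intertwine as
  \<open>m \<otimes> u = u \<otimes> s m\<close>. The orientation
  \<open>u \<otimes> m = s m \<otimes> u\<close>, which fits \<open>t a = \<sigma>(a) t\<close>, is
  satisfied by the inverse.\<close>

theorem skolem_noether_subfield:
  assumes Z: "subfield (ring_center R) R" and M: "subring M R" "dimension n (ring_center R) M"
    and s: "\<And>x. x \<in> M \<Longrightarrow> s x \<in> carrier R" "s \<one> = \<one>"
      "\<And>x y. x \<in> M \<Longrightarrow> y \<in> M \<Longrightarrow> s (x \<oplus> y) = s x \<oplus> s y"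
      "\<And>x y. x \<in> M \<Longrightarrow> y \<in> M \<Longrightarrow> s (x \<otimes> y) = s x \<otimes> s y"
      "\<And>z. z \<in> ring_center R \<Longrightarrow> z \<in> M \<and> s z = z"
  shows "\<exists>u\<in>carrier R - {\<zero>}. \<forall>m\<in>M. u \<otimes> m = s m \<otimes> u"
proof -
  have Mc: "M \<subseteq> carrier R" using subringE(1)[OF M(1)] .
  have "\<exists>f. bimult f \<and> (\<forall>m\<in>M. f m = s m)"
    using s by (intro linear_map_is_bimult[OF Z M(2)]) auto
  then obtain f where f: "bimult f" "\<forall>m\<in>M. f m = s m" by blast
  obtain I x b where I: "finite (I :: nat set)" "x \<in> I \<rightarrow> carrier R" "b \<in> I \<rightarrow> carrier R"
      "\<forall>m\<in>carrier R. f m = (\<Oplus>i\<in>I. x i \<otimes> m \<otimes> b i)"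
    using bimult_representation[OF f(1)] by blast
  have rep: "s m = (\<Oplus>i\<in>I. x i \<otimes> m \<otimes> b i)" if "m \<in> M" for m
    using f(2)[rule_format, OF that, symmetric] I(4) that Mc by auto
  have "\<exists>u\<in>carrier R - {\<zero>}. \<forall>m\<in>M. m \<otimes> u = u \<otimes> s m"
    by (rule intertwiner_from_representation[OF M(1) s(1,2,4) I(1-3) rep])
  then obtain u where u: "u \<in> carrier R" "u \<noteq> \<zero>" "\<And>m. m \<in> M \<Longrightarrow> m \<otimes> u = u \<otimes> s m" by blast
  note i = inv_props[OF u(1,2)]
  have "inv u \<otimes> m = s m \<otimes> inv u" if m: "m \<in> M" for m
  proof -
    have c: "m \<in> carrier R" "s m \<in> carrier R" using m Mc s by auto
    have "inv u \<otimes> m = inv u \<otimes> (m \<otimes> u) \<otimes> inv u" using c i u(1) by (simp add: m_assoc)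
    also have "\<dots> = inv u \<otimes> u \<otimes> s m \<otimes> inv u" using u(3)[OF m] c i(1) u(1) by (simp add: m_assoc)
    finally show ?thesis using c i by simp
  qed
  then show ?thesis using i by blast
qed

text \<open>Dedekind's argument: replace \<open>m\<close> by \<open>m0 \<otimes> m\<close> and
  subtract \<open>s p m0\<close> times the relation. The term at \<open>p\<close> cancels, and the
  coefficient at \<open>i\<close> becomes \<open>a i\<close> times
  \<open>s i m0 \<ominus> s p m0\<close>, again in the field \<open>M\<close>. The weights on the
  right are never touched, so they may be arbitrary non-zero elements of \<open>R\<close>: powers of
  \<open>u\<close> for the independence of those powers, and \<open>\<one>\<close> for the bound on
  the degree over the fixed field.\<close>

lemma weighted_dedekind:
  assumes M: "subfield M R" and I: "finite I"
    and s: "\<And>i x. i \<in> I \<Longrightarrow> x \<in> M \<Longrightarrow> s i x \<in> M" "\<And>i. i \<in> I \<Longrightarrow> s i \<one> = \<one>"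
      "\<And>i x y. i \<in> I \<Longrightarrow> x \<in> M \<Longrightarrow> y \<in> M \<Longrightarrow> s i (x \<otimes> y) = s i x \<otimes> s i y"
      "\<And>i j. i \<in> I \<Longrightarrow> j \<in> I \<Longrightarrow> i \<noteq> j \<Longrightarrow> \<exists>x\<in>M. s i x \<noteq> s j x"
    and w: "\<And>i. i \<in> I \<Longrightarrow> w i \<in> carrier R - {\<zero>}"
    and a: "\<And>i. i \<in> I \<Longrightarrow> a i \<in> M"
    and rel: "\<And>m. m \<in> M \<Longrightarrow> (\<Oplus>i\<in>I. a i \<otimes> s i m \<otimes> w i) = \<zero>"
  shows "\<forall>i\<in>I. a i = \<zero>"
  using I s w a rel
proof (induction I arbitrary: a rule: finite_induct)
  case (insert p I)
  have Mc: "M \<subseteq> carrier R" using subfieldE(3)[OF M] .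
  note Ms = subringE[OF subfieldE(1)[OF M]]
  let ?J = "insert p I"
  have aM: "a i \<in> M" "a i \<in> carrier R" if "i \<in> ?J" for i using insert.prems(6)[OF that] Mc by auto
  have wc: "w i \<in> carrier R" if "i \<in> ?J" for i using insert.prems(5)[OF that] by auto
  have sM: "s i m \<in> M" "s i m \<in> carrier R" if "i \<in> ?J" "m \<in> M" for i m
    using insert.prems(1)[OF that] Mc by auto
  have z: "\<forall>i\<in>I. a i \<otimes> s i m0 \<ominus> s p m0 \<otimes> a i = \<zero>" if m0: "m0 \<in> M" for m0
  proof (rule insert.IH)
    fix m assume m: "m \<in> M"
    have "(\<Oplus>i\<in>I. (a i \<otimes> s i m0 \<ominus> s p m0 \<otimes> a i) \<otimes> s i m \<otimes> w i)
      = (\<Oplus>i\<in>?J. (a i \<otimes> s i m0 \<ominus> s p m0 \<otimes> a i) \<otimes> s i m \<otimes> w i)"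
    proof -
      have "a p \<otimes> s p m0 = s p m0 \<otimes> a p"
        using subfieldE(4)[OF M] aM[of p] sM[of p m0] m0 by auto
      then have "(a p \<otimes> s p m0 \<ominus> s p m0 \<otimes> a p) \<otimes> s p m \<otimes> w p = \<zero>"
        using aM[of p] sM[of p m0] sM[of p m] m m0 wc[of p] by (simp add: minus_eq r_neg)
      then show ?thesis
        using insert.hyps aM sM m m0 wc by (subst finsum_insert) (auto simp: Pi_iff)
    qed
    also have "\<dots> = (\<Oplus>i\<in>?J. a i \<otimes> s i (m0 \<otimes> m) \<otimes> w i \<ominus> s p m0 \<otimes> (a i \<otimes> s i m \<otimes> w i))"
    proof (intro finsum_cong')
      fix i assume i: "i \<in> ?J"
      show "(a i \<otimes> s i m0 \<ominus> s p m0 \<otimes> a i) \<otimes> s i m \<otimes> w i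
          = a i \<otimes> s i (m0 \<otimes> m) \<otimes> w i \<ominus> s p m0 \<otimes> (a i \<otimes> s i m \<otimes> w i)"
        using aM[OF i] sM[OF i m] sM[OF i m0] sM[of p m0] m0 wc[OF i] insert.prems(3)[OF i m0 m]
        by (simp add: minus_eq l_distr l_minus m_assoc)
    qed (use aM sM m m0 wc Ms(6) in auto)
    also have "\<dots> = (\<Oplus>i\<in>?J. a i \<otimes> s i (m0 \<otimes> m) \<otimes> w i) \<ominus> (\<Oplus>i\<in>?J. s p m0 \<otimes> (a i \<otimes> s i m \<otimes> w i))"
      using aM sM m m0 wc Ms(6) by (intro finsum_minus) auto
    also have "(\<Oplus>i\<in>?J. s p m0 \<otimes> (a i \<otimes> s i m \<otimes> w i)) = s p m0 \<otimes> (\<Oplus>i\<in>?J. a i \<otimes> s i m \<otimes> w i)"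
      using aM sM m m0 wc insert.hyps by (intro finsum_rdistr[symmetric]) auto
    also have "(\<Oplus>i\<in>?J. a i \<otimes> s i m \<otimes> w i) = \<zero>" using insert.prems(7)[OF m] .
    also have "(\<Oplus>i\<in>?J. a i \<otimes> s i (m0 \<otimes> m) \<otimes> w i) = \<zero>"
      using insert.prems(7) Ms(6)[OF m0 m] by blast
    finally show "(\<Oplus>i\<in>I. (a i \<otimes> s i m0 \<ominus> s p m0 \<otimes> a i) \<otimes> s i m \<otimes> w i) = \<zero>"
      using sM[of p m0] m0 by (simp add: minus_eq)
  next
    show "a i \<otimes> s i m0 \<ominus> s p m0 \<otimes> a i \<in> M" if "i \<in> I" for i
      using aM sM m0 that Ms(5,6,7) by (simp add: minus_eq)
  qed (use insert.prems(1-5) in auto)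
  have aI: "a i = \<zero>" if i: "i \<in> I" for i
  proof (rule ccontr)
    assume nz: "a i \<noteq> \<zero>"
    have "i \<noteq> p" using i insert.hyps by auto
    then obtain m0 where m0: "m0 \<in> M" "s i m0 \<noteq> s p m0" using insert.prems(4)[of i p] i by auto
    have c: "a i \<in> carrier R" "s i m0 \<in> carrier R" "s p m0 \<in> carrier R"
      using aM[of i] sM[of i] sM[of p] m0 i by auto
    have "s p m0 \<otimes> a i = a i \<otimes> s p m0"
      using subfieldE(4)[OF M] aM[of i] sM[of p m0] m0 i by auto
    then have "a i \<otimes> s i m0 \<ominus> a i \<otimes> s p m0 = \<zero>" using z[OF m0(1)] i by auto
    then have "a i \<otimes> (s i m0 \<ominus> s p m0) = \<zero>"
      using c by (simp add: minus_eq r_distr r_minus)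
    then have "s i m0 \<ominus> s p m0 = \<zero>" using no_zero_div[of "a i" "s i m0 \<ominus> s p m0"] c nz by auto
    then show False using m0(2) c r_right_minus_eq by blast
  qed
  have "(\<Oplus>i\<in>?J. a i \<otimes> s i \<one> \<otimes> w i) = a p \<otimes> w p"
  proof -
    have "(\<Oplus>i\<in>I. a i \<otimes> s i \<one> \<otimes> w i) = \<zero>"
      using aI wc sM Ms(3) by (intro add.finprod_one_eqI) auto
    then show ?thesis
      using insert.hyps aM wc sM Ms(3) insert.prems(2)[of p] by (subst finsum_insert) (auto simp: Pi_iff)
  qed
  then have "a p \<otimes> w p = \<zero>" using insert.prems(7)[OF Ms(3)] by simp
  then have "a p = \<zero>" using no_zero_div[of "a p" "w p"] aM[of p] insert.prems(5)[of p] by auto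
  then show ?case using aI by auto
qed auto

end

subsection \<open>Twisted polynomial rings\<close>

locale twisted_poly = ring R for R (structure) +
  fixes \<sigma> :: "'a \<Rightarrow> 'a"
  assumes hom: "\<sigma> \<in> ring_hom R R"
begin

abbreviation P where "P \<equiv> twisted_poly_ring R \<sigma>"

lemma twist_closed: "x \<in> carrier R \<Longrightarrow> (\<sigma> ^^ i) x \<in> carrier R"
  by (induction i) (use ring_hom_memE(1)[OF hom] in auto)

lemma twist_mult:
  "x \<in> carrier R \<Longrightarrow> y \<in> carrier R \<Longrightarrow> (\<sigma> ^^ i) (x \<otimes> y) = (\<sigma> ^^ i) x \<otimes> (\<sigma> ^^ i) y"
  by (induction i) (use ring_hom_memE(2)[OF hom] twist_closed in auto)

lemma twist_add:
  "x \<in> carrier R \<Longrightarrow> y \<in> carrier R \<Longrightarrow> (\<sigma> ^^ i) (x \<oplus> y) = (\<sigma> ^^ i) x \<oplus> (\<sigma> ^^ i) y"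
  by (induction i) (use ring_hom_memE(3)[OF hom] twist_closed in auto)

lemma twist_one: "(\<sigma> ^^ i) \<one> = \<one>"
  by (induction i) (use ring_hom_memE(4)[OF hom] in auto)

lemma twist_zero: "(\<sigma> ^^ i) \<zero> = \<zero>"
  using twist_add[of \<zero> \<zero> i] twist_closed[of \<zero> i] by simp

lemma P_simps:
  "carrier P = up R"
  "\<one>\<^bsub>P\<^esub> = tw_monom R \<one> 0"
  "\<zero>\<^bsub>P\<^esub> = (\<lambda>i. \<zero>)"
  "p \<oplus>\<^bsub>P\<^esub> q = (\<lambda>i. p i \<oplus> q i)"
  "p \<otimes>\<^bsub>P\<^esub> q = (\<lambda>n. \<Oplus>i\<in>{..n}. p i \<otimes> (\<sigma> ^^ i) (q (n - i)))"
  by (auto simp: twisted_poly_ring_def)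

lemma monom_closed: "a \<in> carrier R \<Longrightarrow> tw_monom R a n \<in> carrier P"
  by (auto simp: P_simps tw_monom_def intro!: mem_upI exI[of _ n])

lemma abelian_group_P: "abelian_group P"
proof (rule abelian_groupI)
  fix p q r assume p: "p \<in> carrier P" and q: "q \<in> carrier P" and r: "r \<in> carrier P"
  note pqr = p[unfolded P_simps] q[unfolded P_simps] r[unfolded P_simps]
  show "p \<oplus>\<^bsub>P\<^esub> q \<in> carrier P" using pqr up_add_closed by (simp add: P_simps)
  show "p \<oplus>\<^bsub>P\<^esub> q \<oplus>\<^bsub>P\<^esub> r = p \<oplus>\<^bsub>P\<^esub> (q \<oplus>\<^bsub>P\<^esub> r)"
    using pqr[THEN mem_upD] by (simp add: P_simps a_assoc)
  show "p \<oplus>\<^bsub>P\<^esub> q = q \<oplus>\<^bsub>P\<^esub> p" using pqr[THEN mem_upD] by (simp add: P_simps a_comm)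
next
  fix p assume p: "p \<in> carrier P"
  then have p': "p \<in> up R" "\<And>i. p i \<in> carrier R" by (auto simp: P_simps)
  show "\<zero>\<^bsub>P\<^esub> \<oplus>\<^bsub>P\<^esub> p = p" using p' by (simp add: P_simps)
  show "\<exists>q\<in>carrier P. q \<oplus>\<^bsub>P\<^esub> p = \<zero>\<^bsub>P\<^esub>"
    using p' up_a_inv_closed[OF p'(1)] by (intro bexI[of _ "\<lambda>i. \<ominus> p i"]) (auto simp: P_simps l_neg)
qed (auto simp: P_simps)

lemma P_mult_closed:
  assumes p: "p \<in> carrier P" and q: "q \<in> carrier P"
  shows "p \<otimes>\<^bsub>P\<^esub> q \<in> carrier P"
proof -
  have c: "p i \<in> carrier R" "q i \<in> carrier R" for i using p q by (auto simp: P_simps)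
  obtain n m where nm: "bound \<zero> n p" "bound \<zero> m q" using p q by (auto simp: P_simps up_def)
  have "bound \<zero> (n + m) (\<lambda>k. \<Oplus>i\<in>{..k}. p i \<otimes> (\<sigma> ^^ i) (q (k - i)))"
  proof
    fix k assume k: "n + m < k"
    show "(\<Oplus>i\<in>{..k}. p i \<otimes> (\<sigma> ^^ i) (q (k - i))) = \<zero>"
    proof (rule add.finprod_one_eqI)
      fix i
      show "p i \<otimes> (\<sigma> ^^ i) (q (k - i)) = \<zero>"
      proof (cases "n < i")
        case True
        then show ?thesis using bound.bound[OF nm(1)] twist_closed c by simp
      next
        case False
        then have "m < k - i" using k by linarith
        then show ?thesis using bound.bound[OF nm(2)] twist_zero c by simp
      qed
    qed
  qed
  moreover have "(\<Oplus>i\<in>{..k}. p i \<otimes> (\<sigma> ^^ i) (q (k - i))) \<in> carrier R" for k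
    using c twist_closed by (intro finsum_closed) auto
  ultimately show ?thesis by (auto simp: P_simps intro!: mem_upI)
qed

lemma P_l_distr:
  assumes "p \<in> carrier P" "q \<in> carrier P" "r \<in> carrier P"
  shows "(p \<oplus>\<^bsub>P\<^esub> q) \<otimes>\<^bsub>P\<^esub> r = p \<otimes>\<^bsub>P\<^esub> r \<oplus>\<^bsub>P\<^esub> q \<otimes>\<^bsub>P\<^esub> r"
proof
  fix n
  have c: "p i \<in> carrier R" "q i \<in> carrier R" "r i \<in> carrier R" for i
    using assms by (auto simp: P_simps)
  have "(\<Oplus>i\<in>{..n}. (p i \<oplus> q i) \<otimes> (\<sigma> ^^ i) (r (n - i)))
      = (\<Oplus>i\<in>{..n}. p i \<otimes> (\<sigma> ^^ i) (r (n - i)) \<oplus> q i \<otimes> (\<sigma> ^^ i) (r (n - i)))"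
    using c twist_closed by (intro finsum_cong') (auto simp: l_distr)
  also have "\<dots> = (\<Oplus>i\<in>{..n}. p i \<otimes> (\<sigma> ^^ i) (r (n - i))) \<oplus> (\<Oplus>i\<in>{..n}. q i \<otimes> (\<sigma> ^^ i) (r (n - i)))"
    using c twist_closed by (intro finsum_addf) auto
  finally show "((p \<oplus>\<^bsub>P\<^esub> q) \<otimes>\<^bsub>P\<^esub> r) n = (p \<otimes>\<^bsub>P\<^esub> r \<oplus>\<^bsub>P\<^esub> q \<otimes>\<^bsub>P\<^esub> r) n" by (simp add: P_simps)
qed

lemma P_r_distr:
  assumes "p \<in> carrier P" "q \<in> carrier P" "r \<in> carrier P"
  shows "r \<otimes>\<^bsub>P\<^esub> (p \<oplus>\<^bsub>P\<^esub> q) = r \<otimes>\<^bsub>P\<^esub> p \<oplus>\<^bsub>P\<^esub> r \<otimes>\<^bsub>P\<^esub> q"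
proof
  fix n
  have c: "p i \<in> carrier R" "q i \<in> carrier R" "r i \<in> carrier R" for i
    using assms by (auto simp: P_simps)
  have "(\<Oplus>i\<in>{..n}. r i \<otimes> (\<sigma> ^^ i) (p (n - i) \<oplus> q (n - i)))
      = (\<Oplus>i\<in>{..n}. r i \<otimes> (\<sigma> ^^ i) (p (n - i)) \<oplus> r i \<otimes> (\<sigma> ^^ i) (q (n - i)))"
    using c twist_closed by (intro finsum_cong') (auto simp: r_distr twist_add)
  also have "\<dots> = (\<Oplus>i\<in>{..n}. r i \<otimes> (\<sigma> ^^ i) (p (n - i))) \<oplus> (\<Oplus>i\<in>{..n}. r i \<otimes> (\<sigma> ^^ i) (q (n - i)))"
    using c twist_closed by (intro finsum_addf) auto
  finally show "(r \<otimes>\<^bsub>P\<^esub> (p \<oplus>\<^bsub>P\<^esub> q)) n = (r \<otimes>\<^bsub>P\<^esub> p \<oplus>\<^bsub>P\<^esub> r \<otimes>\<^bsub>P\<^esub> q) n" by (simp add: P_simps)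
qed

lemma monom_mult:
  assumes a: "a \<in> carrier R" and b: "b \<in> carrier R"
  shows "tw_monom R a i \<otimes>\<^bsub>P\<^esub> tw_monom R b j = tw_monom R (a \<otimes> (\<sigma> ^^ i) b) (i + j)"
proof
  fix n
  let ?t = "\<lambda>k. tw_monom R a i k \<otimes> (\<sigma> ^^ k) (tw_monom R b j (n - k))"
  have sb: "(\<sigma> ^^ k) b \<in> carrier R" for k using twist_closed b .
  show "(tw_monom R a i \<otimes>\<^bsub>P\<^esub> tw_monom R b j) n = tw_monom R (a \<otimes> (\<sigma> ^^ i) b) (i + j) n"
  proof (cases "i \<le> n")
    case True
    have "(\<Oplus>k\<in>{..n}. ?t k) = (\<Oplus>k\<in>{..n}. if i = k then ?t k else \<zero>)"
      using a b sb twist_zero by (intro finsum_cong') (auto simp: tw_monom_def)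
    also have "\<dots> = ?t i"
      using True a b sb twist_zero by (intro finsum_singleton) (auto simp: tw_monom_def)
    also have "\<dots> = tw_monom R (a \<otimes> (\<sigma> ^^ i) b) (i + j) n"
      using True a twist_zero by (auto simp: tw_monom_def)
    finally show ?thesis by (simp add: P_simps)
  next
    case False
    then have "(\<Oplus>k\<in>{..n}. ?t k) = \<zero>"
      using b sb twist_zero by (intro add.finprod_one_eqI) (auto simp: tw_monom_def)
    then show ?thesis using False by (simp add: P_simps tw_monom_def)
  qed
qed

text \<open>Associativity of the product and multiplicativity of evaluation are additive in each
  argument. Reducing them to monomials avoids any rearrangement of double sums.\<close>

lemma P_induct [consumes 1, case_names monom add]:
  assumes p: "p \<in> carrier P"
    and monom: "\<And>a n. a \<in> carrier R \<Longrightarrow> Q (tw_monom R a n)"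
    and add: "\<And>p q. p \<in> carrier P \<Longrightarrow> q \<in> carrier P \<Longrightarrow> Q p \<Longrightarrow> Q q \<Longrightarrow> Q (p \<oplus>\<^bsub>P\<^esub> q)"
  shows "Q p"
proof -
  have c: "p \<in> up R" "p i \<in> carrier R" for i using p by (auto simp: P_simps)
  obtain N where "bound \<zero> N p" using c(1) by blast
  then have "\<forall>i>N. p i = \<zero>" by auto
  then show ?thesis using p
  proof (induction N arbitrary: p)
    case 0
    then have "p = tw_monom R (p 0) 0" by (auto simp: tw_monom_def)
    then show ?case using monom[of "p 0" 0] 0 by (auto simp: P_simps)
  next
    case (Suc N)
    have c: "p i \<in> carrier R" for i using Suc.prems(2) by (auto simp: P_simps)
    let ?q = "p(Suc N := \<zero>)"
    have q: "\<forall>i>N. ?q i = \<zero>" using Suc.prems(1) by auto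
    then have qc: "?q \<in> carrier P" using c by (auto simp: P_simps intro!: mem_upI exI[of _ N])
    have "p = tw_monom R (p (Suc N)) (Suc N) \<oplus>\<^bsub>P\<^esub> ?q"
      using c by (auto simp: P_simps tw_monom_def)
    moreover have "Q (tw_monom R (p (Suc N)) (Suc N) \<oplus>\<^bsub>P\<^esub> ?q)"
      using add[OF monom_closed[OF c] qc monom[OF c] Suc.IH[OF q qc]] .
    ultimately show ?case by simp
  qed
qed

lemma P_assoc:
  assumes p: "p \<in> carrier P" and q: "q \<in> carrier P" and r: "r \<in> carrier P"
  shows "(p \<otimes>\<^bsub>P\<^esub> q) \<otimes>\<^bsub>P\<^esub> r = p \<otimes>\<^bsub>P\<^esub> (q \<otimes>\<^bsub>P\<^esub> r)"
  using p
proof (induction rule: P_induct)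
  case (add p p')
  then show ?case using q r by (simp add: P_l_distr P_mult_closed)
next
  case (monom a i)
  show ?case using q
  proof (induction rule: P_induct)
    case (add q q')
    then show ?case
      using r monom_closed[OF monom] by (simp add: P_l_distr P_r_distr P_mult_closed)
  next
    case (monom b j)
    note b = this
    show ?case using r
    proof (induction rule: P_induct)
      case (add r r')
      then show ?case
        using monom_closed[OF \<open>a \<in> carrier R\<close>] monom_closed[OF b] by (simp add: P_r_distr P_mult_closed)
    next
      case (monom c k)
      \<comment> \<open>For monomials, associativity amounts to this law of exponents together with
        multiplicativity of the iterates of \<open>\<sigma>\<close>.\<close>
      have "(\<sigma> ^^ (i + j)) c = (\<sigma> ^^ i) ((\<sigma> ^^ j) c)" by (simp add: funpow_add)
      then show ?case
        using \<open>a \<in> carrier R\<close> b monom by (simp add: monom_mult twist_closed twist_mult m_assoc add.assoc)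
    qed
  qed
qed

lemma ring_P: "ring P"
proof (rule ringI[OF abelian_group_P])
  show "monoid P"
  proof (rule monoidI)
    show "\<one>\<^bsub>P\<^esub> \<in> carrier P" using monom_closed[OF one_closed] by (simp add: P_simps)
    fix p assume p: "p \<in> carrier P"
    show "\<one>\<^bsub>P\<^esub> \<otimes>\<^bsub>P\<^esub> p = p" using p
    proof (induction rule: P_induct)
      case (add p q)
      then show ?case using P_r_distr[of p q "\<one>\<^bsub>P\<^esub>"] monom_closed[OF one_closed] by (simp add: P_simps(2))
    qed (simp add: P_simps(2) monom_mult)
    show "p \<otimes>\<^bsub>P\<^esub> \<one>\<^bsub>P\<^esub> = p" using p
    proof (induction rule: P_induct)
      case (add p q)
      then show ?case using P_l_distr[of p q "\<one>\<^bsub>P\<^esub>"] monom_closed[OF one_closed] by (simp add: P_simps(2))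
    qed (simp add: P_simps(2) monom_mult twist_one)
  qed (auto intro: P_mult_closed P_assoc)
qed (auto intro: P_l_distr P_r_distr)

lemma monom_pow: "tw_monom R \<one> 1 [^]\<^bsub>P\<^esub> (n::nat) = tw_monom R \<one> n"
proof -
  interpret P: ring P by (rule ring_P)
  show ?thesis by (induction n) (auto simp: P_simps(2) monom_mult twist_one)
qed

lemma cyclic_ideal_eq:
  "cyclic_ideal R \<sigma> h c = {p \<otimes>\<^bsub>P\<^esub> (tw_monom R \<one> h \<ominus>\<^bsub>P\<^esub> tw_monom R c 0) | p. p \<in> carrier P}"
  using monom_pow[of h] by (simp add: cyclic_ideal_def Let_def)

text \<open>One step rewrites \<open>a t^n\<close> as
  \<open>(a t^k)(t^h - c) + a \<sigma>^k(c) t^k\<close> with \<open>k = n - h\<close>; since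
  \<open>h\<close> is positive, the exponent drops. The quotient stands to the left of
  \<open>t^h - c\<close>, as the left ideal requires.\<close>

lemma division:
  assumes h: "0 < h" and c: "c \<in> carrier R" and p: "p \<in> carrier P"
  shows "\<exists>q\<in>carrier P. \<exists>r\<in>carrier P. (\<forall>i\<ge>h. r i = \<zero>) \<and>
    p = q \<otimes>\<^bsub>P\<^esub> (tw_monom R \<one> h \<ominus>\<^bsub>P\<^esub> tw_monom R c 0) \<oplus>\<^bsub>P\<^esub> r"
proof -
  interpret P: ring P by (rule ring_P)
  let ?f = "tw_monom R \<one> h \<ominus>\<^bsub>P\<^esub> tw_monom R c 0"
  have fc: "?f \<in> carrier P" using monom_closed c by auto
  show ?thesis using p
  proof (induction rule: P_induct)
    case (add p p')
    then obtain q r q' r' where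
      "q \<in> carrier P" "r \<in> carrier P" "\<forall>i\<ge>h. r i = \<zero>" "p = q \<otimes>\<^bsub>P\<^esub> ?f \<oplus>\<^bsub>P\<^esub> r"
      "q' \<in> carrier P" "r' \<in> carrier P" "\<forall>i\<ge>h. r' i = \<zero>" "p' = q' \<otimes>\<^bsub>P\<^esub> ?f \<oplus>\<^bsub>P\<^esub> r'" by blast
    moreover from this have "p \<oplus>\<^bsub>P\<^esub> p' = (q \<oplus>\<^bsub>P\<^esub> q') \<otimes>\<^bsub>P\<^esub> ?f \<oplus>\<^bsub>P\<^esub> (r \<oplus>\<^bsub>P\<^esub> r')"
      using fc by (simp add: P.l_distr P.a_ac)
    moreover from calculation have "\<forall>i\<ge>h. (r \<oplus>\<^bsub>P\<^esub> r') i = \<zero>" by (simp add: P_simps)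
    ultimately show ?case by blast
  next
    case (monom a n)
    then show ?case
    proof (induction n arbitrary: a rule: less_induct)
      case (less n)
      show ?case
      proof (cases "n < h")
        case True
        then have "\<forall>i\<ge>h. tw_monom R a n i = \<zero>" by (auto simp: tw_monom_def)
        then show ?thesis using monom_closed[OF less.prems] fc
          by (intro bexI[of _ "\<zero>\<^bsub>P\<^esub>"] bexI[of _ "tw_monom R a n"]) auto
      next
        case False
        define k where "k = n - h"
        have k: "k < n" "k + h = n" using False h by (auto simp: k_def)
        define b where "b = a \<otimes> (\<sigma> ^^ k) c"
        have b: "b \<in> carrier R" using less.prems c twist_closed by (simp add: b_def)
        have m: "tw_monom R a k \<in> carrier P" "tw_monom R b k \<in> carrier P" "tw_monom R a n \<in> carrier P"
          using monom_closed less.prems b by auto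
        have "tw_monom R a k \<otimes>\<^bsub>P\<^esub> ?f = tw_monom R a n \<ominus>\<^bsub>P\<^esub> tw_monom R b k"
          using monom_mult[OF less.prems one_closed, of k h] monom_mult[OF less.prems c, of k 0]
            m c monom_closed less.prems k
          by (simp add: P.minus_eq P.r_distr P.r_minus twist_one b_def)
        then have e: "tw_monom R a n = tw_monom R a k \<otimes>\<^bsub>P\<^esub> ?f \<oplus>\<^bsub>P\<^esub> tw_monom R b k"
          using m by (simp add: P.minus_eq P.a_assoc P.l_neg)
        obtain q r where qr: "q \<in> carrier P" "r \<in> carrier P" "\<forall>i\<ge>h. r i = \<zero>"
          "tw_monom R b k = q \<otimes>\<^bsub>P\<^esub> ?f \<oplus>\<^bsub>P\<^esub> r" using less.IH[OF k(1) b] by blast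
        have "tw_monom R a n = (tw_monom R a k \<oplus>\<^bsub>P\<^esub> q) \<otimes>\<^bsub>P\<^esub> ?f \<oplus>\<^bsub>P\<^esub> r"
          unfolding e qr(4) using qr(1,2) m fc by (simp add: P.l_distr P.a_ac)
        then show ?thesis using qr(1-3) m by blast
      qed
    qed
  qed
qed

end

subsection \<open>Evaluation of twisted polynomials\<close>

text \<open>The hypothesis \<open>intertwine\<close> is the relation
  \<open>t a = \<sigma>(a) t\<close> read in \<open>S\<close>, exactly what makes
  \<open>t \<mapsto> u\<close> multiplicative. In the application \<open>g\<close> is the inclusion
  of \<open>M\<close> into \<open>A\<close>.\<close>

locale twisted_eval = twisted_poly R \<sigma> + S: ring S
  for R :: "('a, 'b) ring_scheme" (structure) and \<sigma> and S :: "('c, 'd) ring_scheme" (structure) +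
  fixes g :: "'a \<Rightarrow> 'c" and u :: 'c
  assumes g: "g \<in> ring_hom R S" and u: "u \<in> carrier S"
    and intertwine: "a \<in> carrier R \<Longrightarrow> u \<otimes>\<^bsub>S\<^esub> g a = g (\<sigma> a) \<otimes>\<^bsub>S\<^esub> u"
begin

text \<open>Summation over the support, which is finite on the carrier, makes the value independent
  of a degree bound. Any bound may be introduced later, for instance one common to two
  polynomials.\<close>

definition ev :: "(nat \<Rightarrow> 'a) \<Rightarrow> 'c" where
  "ev p = (\<Oplus>\<^bsub>S\<^esub>i\<in>{i. p i \<noteq> \<zero>\<^bsub>R\<^esub>}. g (p i) \<otimes>\<^bsub>S\<^esub> u [^]\<^bsub>S\<^esub> i)"

lemma g_closed: "a \<in> carrier R \<Longrightarrow> g a \<in> carrier S"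
  using ring_hom_memE(1)[OF g] .

lemma g_zero: "g \<zero>\<^bsub>R\<^esub> = \<zero>\<^bsub>S\<^esub>"
  using ring_hom_zero[OF g] ring_axioms S.ring_axioms by blast

lemma intertwine_pow:
  "a \<in> carrier R \<Longrightarrow> u [^]\<^bsub>S\<^esub> (i::nat) \<otimes>\<^bsub>S\<^esub> g a = g ((\<sigma> ^^ i) a) \<otimes>\<^bsub>S\<^esub> u [^]\<^bsub>S\<^esub> i"
proof (induction i arbitrary: a)
  case (Suc i)
  have "\<sigma> a \<in> carrier R" using Suc.prems ring_hom_memE(1)[OF hom] by blast
  moreover have "(\<sigma> ^^ Suc i) a = (\<sigma> ^^ i) (\<sigma> a)" by (simp add: funpow_swap1)
  moreover have "u [^]\<^bsub>S\<^esub> Suc i \<otimes>\<^bsub>S\<^esub> g a = u [^]\<^bsub>S\<^esub> i \<otimes>\<^bsub>S\<^esub> g (\<sigma> a) \<otimes>\<^bsub>S\<^esub> u"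
    using u g_closed Suc.prems intertwine calculation(1) by (simp add: S.m_assoc)
  ultimately show ?case
    using Suc.IH[of "\<sigma> a"] u g_closed twist_closed by (simp add: S.m_assoc)
qed (use u g_closed in auto)

lemma ev_eq_sum:
  assumes "p \<in> carrier P" "\<And>i. i > N \<Longrightarrow> p i = \<zero>\<^bsub>R\<^esub>"
  shows "ev p = (\<Oplus>\<^bsub>S\<^esub>i\<in>{..N}. g (p i) \<otimes>\<^bsub>S\<^esub> u [^]\<^bsub>S\<^esub> i)"
  unfolding ev_def
proof (rule S.add.finprod_mono_neutral_cong_left)
  show "{i. p i \<noteq> \<zero>\<^bsub>R\<^esub>} \<subseteq> {..N}" using assms(2) by (auto simp: not_less[symmetric])
qed (use assms u g_closed g_zero in \<open>auto simp: P_simps\<close>)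

lemma P_bound:
  assumes "p \<in> carrier P"
  shows "\<exists>N. \<forall>i>N. p i = \<zero>\<^bsub>R\<^esub>"
  using assms by (auto simp: P_simps up_def bound_def)

lemma ev_closed: "p \<in> carrier P \<Longrightarrow> ev p \<in> carrier S"
  unfolding ev_def using u g_closed by (intro S.finsum_closed) (auto simp: P_simps)

lemma ev_add:
  assumes p: "p \<in> carrier P" and q: "q \<in> carrier P"
  shows "ev (p \<oplus>\<^bsub>P\<^esub> q) = ev p \<oplus>\<^bsub>S\<^esub> ev q"
proof -
  interpret P: ring P by (rule ring_P)
  obtain N where N: "\<And>i. i > N \<Longrightarrow> p i = \<zero>\<^bsub>R\<^esub>" using P_bound[OF p] by blast
  obtain N' where N': "\<And>i. i > N' \<Longrightarrow> q i = \<zero>\<^bsub>R\<^esub>" using P_bound[OF q] by blast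
  define B where "B = max N N'"
  have B: "p i = \<zero>\<^bsub>R\<^esub>" "q i = \<zero>\<^bsub>R\<^esub>" if "i > B" for i using that N N' by (auto simp: B_def)
  have c: "p i \<in> carrier R" "q i \<in> carrier R" for i using p q by (auto simp: P_simps)
  have pq: "(p \<oplus>\<^bsub>P\<^esub> q) i = p i \<oplus>\<^bsub>R\<^esub> q i" for i by (simp add: P_simps)
  have "ev (p \<oplus>\<^bsub>P\<^esub> q) = (\<Oplus>\<^bsub>S\<^esub>i\<in>{..B}. g ((p \<oplus>\<^bsub>P\<^esub> q) i) \<otimes>\<^bsub>S\<^esub> u [^]\<^bsub>S\<^esub> i)"
    using B p q by (intro ev_eq_sum) (auto simp: pq)
  also have "\<dots> = (\<Oplus>\<^bsub>S\<^esub>i\<in>{..B}. g (p i) \<otimes>\<^bsub>S\<^esub> u [^]\<^bsub>S\<^esub> i \<oplus>\<^bsub>S\<^esub> g (q i) \<otimes>\<^bsub>S\<^esub> u [^]\<^bsub>S\<^esub> i)"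
    using c u g_closed ring_hom_memE(3)[OF g]
    by (intro S.finsum_cong') (auto simp: pq S.l_distr)
  also have "\<dots> = (\<Oplus>\<^bsub>S\<^esub>i\<in>{..B}. g (p i) \<otimes>\<^bsub>S\<^esub> u [^]\<^bsub>S\<^esub> i) \<oplus>\<^bsub>S\<^esub> (\<Oplus>\<^bsub>S\<^esub>i\<in>{..B}. g (q i) \<otimes>\<^bsub>S\<^esub> u [^]\<^bsub>S\<^esub> i)"
    using c u g_closed by (intro S.finsum_addf) auto
  finally show ?thesis using ev_eq_sum[OF p B(1)] ev_eq_sum[OF q B(2)] by simp
qed

lemma ev_monom:
  assumes "a \<in> carrier R"
  shows "ev (tw_monom R a n) = g a \<otimes>\<^bsub>S\<^esub> u [^]\<^bsub>S\<^esub> n"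
proof -
  have "ev (tw_monom R a n) = (\<Oplus>\<^bsub>S\<^esub>i\<in>{..n}. g (tw_monom R a n i) \<otimes>\<^bsub>S\<^esub> u [^]\<^bsub>S\<^esub> i)"
    using monom_closed[OF assms] by (intro ev_eq_sum) (auto simp: tw_monom_def)
  also have "\<dots> = (\<Oplus>\<^bsub>S\<^esub>i\<in>{..n}. if n = i then g a \<otimes>\<^bsub>S\<^esub> u [^]\<^bsub>S\<^esub> i else \<zero>\<^bsub>S\<^esub>)"
    using assms u g_closed g_zero by (intro S.finsum_cong') (auto simp: tw_monom_def)
  also have "\<dots> = g a \<otimes>\<^bsub>S\<^esub> u [^]\<^bsub>S\<^esub> n"
    using assms u g_closed by (intro S.finsum_singleton) auto
  finally show ?thesis .
qed

lemma ev_mult: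
  assumes p: "p \<in> carrier P" and q: "q \<in> carrier P"
  shows "ev (p \<otimes>\<^bsub>P\<^esub> q) = ev p \<otimes>\<^bsub>S\<^esub> ev q"
  using p
proof (induction rule: P_induct)
  case (add p p')
  then show ?case using q by (simp add: P_l_distr ev_add P_mult_closed ev_closed S.l_distr)
next
  case (monom a i)
  show ?case using q
  proof (induction rule: P_induct)
    case (add q q')
    then show ?case
      using monom_closed[OF monom] by (simp add: P_r_distr ev_add P_mult_closed ev_closed S.r_distr)
  next
    case (monom b j)
    have c: "g a \<in> carrier S" "g b \<in> carrier S" "g ((\<sigma> ^^ i) b) \<in> carrier S"
      using g_closed twist_closed \<open>a \<in> carrier R\<close> monom by auto
    have "g (a \<otimes>\<^bsub>R\<^esub> (\<sigma> ^^ i) b) \<otimes>\<^bsub>S\<^esub> u [^]\<^bsub>S\<^esub> (i + j)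
        = g a \<otimes>\<^bsub>S\<^esub> (g ((\<sigma> ^^ i) b) \<otimes>\<^bsub>S\<^esub> u [^]\<^bsub>S\<^esub> i) \<otimes>\<^bsub>S\<^esub> u [^]\<^bsub>S\<^esub> j"
      using c u ring_hom_memE(2)[OF g \<open>a \<in> carrier R\<close> twist_closed[OF monom]]
      by (simp add: S.m_assoc S.nat_pow_mult[symmetric])
    also have "\<dots> = (g a \<otimes>\<^bsub>S\<^esub> u [^]\<^bsub>S\<^esub> i) \<otimes>\<^bsub>S\<^esub> (g b \<otimes>\<^bsub>S\<^esub> u [^]\<^bsub>S\<^esub> j)"
      using c u by (simp add: intertwine_pow[OF monom, symmetric] S.m_assoc)
    finally show ?case
      using \<open>a \<in> carrier R\<close> monom by (simp add: monom_mult ev_monom twist_closed)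
  qed
qed

lemma ev_ring_hom: "ring_hom_ring P S ev"
proof (rule ring_hom_ringI2[OF ring_P S.ring_axioms])
  show "ev \<in> ring_hom P S"
    using ev_closed ev_mult ev_add ev_monom[OF one_closed, of 0] ring_hom_memE(4)[OF g]
    by (intro ring_hom_memI) (auto simp: P_simps(2))
qed

text \<open>The hypothesis \<open>indep\<close> is what turns division into a description of the
  kernel: the remainder of a kernel element has degree below \<open>h\<close> and value zero, so it
  is zero.\<close>

lemma kernel_ev:
  assumes h: "0 < h" and c: "c \<in> carrier R" "g c = u [^]\<^bsub>S\<^esub> h"
    and indep: "\<And>r. r \<in> carrier P \<Longrightarrow> \<forall>i\<ge>h. r i = \<zero>\<^bsub>R\<^esub> \<Longrightarrow> ev r = \<zero>\<^bsub>S\<^esub> \<Longrightarrow> r = \<zero>\<^bsub>P\<^esub>"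
  shows "a_kernel P S ev = cyclic_ideal R \<sigma> h c"
proof -
  interpret E: ring_hom_ring P S ev by (rule ev_ring_hom)
  let ?f = "tw_monom R \<one>\<^bsub>R\<^esub> h \<ominus>\<^bsub>P\<^esub> tw_monom R c 0"
  have fc: "?f \<in> carrier P" using monom_closed c by auto
  have "ev ?f = u [^]\<^bsub>S\<^esub> h \<ominus>\<^bsub>S\<^esub> u [^]\<^bsub>S\<^esub> h"
    using monom_closed c ev_monom[OF one_closed, of h] ev_monom[OF c(1), of 0] ring_hom_memE(4)[OF g] u
    by (simp add: E.R.minus_eq S.minus_eq)
  then have f0: "ev ?f = \<zero>\<^bsub>S\<^esub>" using u by (simp add: S.minus_eq S.r_neg)
  have "p \<in> cyclic_ideal R \<sigma> h c" if p: "p \<in> carrier P" "ev p = \<zero>\<^bsub>S\<^esub>" for p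
  proof -
    obtain q r where qr: "q \<in> carrier P" "r \<in> carrier P" "\<forall>i\<ge>h. r i = \<zero>\<^bsub>R\<^esub>"
      "p = q \<otimes>\<^bsub>P\<^esub> ?f \<oplus>\<^bsub>P\<^esub> r" using division[OF h c(1) p(1)] by blast
    have "ev r = \<zero>\<^bsub>S\<^esub>"
      using p(2) qr fc f0 ev_closed by (simp add: ev_add ev_mult P_mult_closed)
    then have "r = \<zero>\<^bsub>P\<^esub>" using indep qr by blast
    then show ?thesis using qr fc by (auto simp: cyclic_ideal_eq)
  qed
  moreover have "ev (q \<otimes>\<^bsub>P\<^esub> ?f) = \<zero>\<^bsub>S\<^esub>" if "q \<in> carrier P" for q
    using that fc f0 ev_closed by (simp add: ev_mult)
  ultimately show ?thesis
    using fc P_mult_closed unfolding a_kernel_def' by (fastforce simp: cyclic_ideal_eq)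
qed

end

subsection \<open>The subalgebra generated by a subfield and an intertwining element\<close>

context ring
begin

lemma combine_eq_finsum:
  assumes "length Ks = length Us" "set Ks \<subseteq> carrier R" "set Us \<subseteq> carrier R"
  shows "combine Ks Us = (\<Oplus>i\<in>{..<length Us}. Ks ! i \<otimes> Us ! i)"
  using assms
proof (induction Ks Us rule: list_induct2)
  case (Cons k Ks u Us)
  have c: "Ks ! i \<in> carrier R" "Us ! i \<in> carrier R" if "i < length Us" for i
    using that Cons nth_mem[of i Ks] nth_mem[of i Us] by auto
  have "{..<length (u # Us)} = insert 0 (Suc ` {..<length Us})"
    by (simp add: lessThan_Suc_eq_insert_0)
  moreover have "(\<Oplus>i\<in>insert 0 (Suc ` {..<length Us}). (k # Ks) ! i \<otimes> (u # Us) ! i)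
      = k \<otimes> u \<oplus> (\<Oplus>i\<in>Suc ` {..<length Us}. (k # Ks) ! i \<otimes> (u # Us) ! i)"
    using c Cons.prems by (subst finsum_insert) auto
  moreover have "(\<Oplus>i\<in>Suc ` {..<length Us}. (k # Ks) ! i \<otimes> (u # Us) ! i)
      = (\<Oplus>i\<in>{..<length Us}. Ks ! i \<otimes> Us ! i)"
    using c by (subst finsum_reindex) auto
  ultimately show ?case using Cons by simp
qed auto

end

lemma (in skewfield) skewfield_subring:
  assumes "subring B R" "\<And>x. x \<in> B \<Longrightarrow> x \<noteq> \<zero> \<Longrightarrow> inv x \<in> B"
  shows "skewfield (R\<lparr>carrier := B\<rparr>)"
proof -
  interpret B: ring "R\<lparr>carrier := B\<rparr>" using subring_is_ring[OF assms(1)] .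
  show ?thesis
    by unfold_locales (use one_neq_zero Units_subring[OF assms] in auto)
qed

lemma carrier_update: "carrier (R\<lparr>carrier := B\<rparr>) = B"
  by simp

text \<open>No order of \<open>s\<close> is fixed at this level: independence of the powers of
  \<open>u\<close>, proved here, is what later excludes infinite order.\<close>

locale twisted_extension = skewfield R for R (structure) +
  fixes M :: "'a set" and s :: "'a \<Rightarrow> 'a" and u :: 'a
  assumes M: "subfield M R"
    and s_hom: "s \<in> ring_hom (R\<lparr>carrier := M\<rparr>) (R\<lparr>carrier := M\<rparr>)"
    and u_carr: "u \<in> carrier R" and u_nz: "u \<noteq> \<zero>"
    and u_twist: "m \<in> M \<Longrightarrow> u \<otimes> m = s m \<otimes> u"
begin

abbreviation "L \<equiv> R\<lparr>carrier := M\<rparr>"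

lemma M_sub: "subring M R" and Mc: "M \<subseteq> carrier R"
  using subfieldE(1,3)[OF M] by auto

sublocale T: twisted_eval L s R "\<lambda>x. x" u
proof -
  interpret L: ring L using subring_is_ring[OF M_sub] .
  show "twisted_eval L s R (\<lambda>x. x) u"
    by unfold_locales (use s_hom u_carr u_twist Mc in \<open>auto intro!: ring_hom_memI\<close>)
qed

lemma u_pow: "u [^] (n::nat) \<in> carrier R" "u [^] (n::nat) \<noteq> \<zero>"
  using u_carr u_nz nat_pow_nonzero by auto

lemma s_pow:
  "m \<in> M \<Longrightarrow> (s ^^ i) m \<in> M"
  "m \<in> M \<Longrightarrow> n \<in> M \<Longrightarrow> (s ^^ i) (m \<otimes> n) = (s ^^ i) m \<otimes> (s ^^ i) n"
  "m \<in> M \<Longrightarrow> n \<in> M \<Longrightarrow> (s ^^ i) (m \<oplus> n) = (s ^^ i) m \<oplus> (s ^^ i) n"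
  "(s ^^ i) \<one> = \<one>"
  using T.twist_closed[of m i] T.twist_mult[of m n i] T.twist_add[of m n i] T.twist_one[of i] by auto

lemma u_pow_twist: "m \<in> M \<Longrightarrow> u [^] (i::nat) \<otimes> m = (s ^^ i) m \<otimes> u [^] i"
  using T.intertwine_pow[of m i] by simp

text \<open>Multiplying the relation by \<open>m\<close> on the right and moving \<open>m\<close>
  past \<open>u [^] i\<close> inserts the factor \<open>(s ^^ i) m\<close>. As \<open>m\<close>
  varies this is a Dedekind relation with weights \<open>u [^] i\<close>.\<close>

lemma powers_coefficients_zero:
  assumes dist: "\<And>i j. i < j \<Longrightarrow> j < n \<Longrightarrow> \<exists>m\<in>M. (s ^^ i) m \<noteq> (s ^^ j) m"
    and a: "\<And>i. i < n \<Longrightarrow> a i \<in> M" and z: "(\<Oplus>i\<in>{..<n}. a i \<otimes> u [^] i) = \<zero>"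
  shows "\<forall>i\<in>{..<n}. a i = \<zero>"
proof (rule weighted_dedekind[OF M, where s = "\<lambda>i. s ^^ i" and w = "\<lambda>i. u [^] i"])
  fix m assume m: "m \<in> M"
  have c: "a i \<in> carrier R" "(s ^^ i) m \<in> carrier R" if "i < n" for i
    using a[OF that] s_pow(1)[OF m] Mc by auto
  have "(\<Oplus>i\<in>{..<n}. a i \<otimes> (s ^^ i) m \<otimes> u [^] i) = (\<Oplus>i\<in>{..<n}. a i \<otimes> u [^] i \<otimes> m)"
    using c m Mc u_pow u_pow_twist[OF m] by (intro finsum_cong') (auto simp: m_assoc)
  also have "\<dots> = (\<Oplus>i\<in>{..<n}. a i \<otimes> u [^] i) \<otimes> m"
    using c m Mc u_pow by (intro finsum_ldistr[symmetric]) auto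
  finally show "(\<Oplus>i\<in>{..<n}. a i \<otimes> (s ^^ i) m \<otimes> u [^] i) = \<zero>" using z m Mc by auto
next
  fix i j assume "i \<in> {..<n}" "j \<in> {..<n}" "i \<noteq> j"
  then show "\<exists>x\<in>M. (s ^^ i) x \<noteq> (s ^^ j) x"
    using dist[of i j] dist[of j i] by (metis lessThan_iff linorder_neqE_nat)
qed (use a s_pow u_pow in auto)

definition "us n = map (\<lambda>i. u [^] i) [0..<n]"

lemma us_carrier: "set (us n) \<subseteq> carrier R"
  using u_pow by (auto simp: us_def)

lemma length_us: "length (us n) = n"
  by (simp add: us_def)

lemma independent_powers:
  assumes dist: "\<And>i j. i < j \<Longrightarrow> j < n \<Longrightarrow> \<exists>m\<in>M. (s ^^ i) m \<noteq> (s ^^ j) m"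
  shows "independent M (us n)"
proof (rule ccontr)
  assume "\<not> independent M (us n)"
  then obtain Ks where Ks: "length Ks = length (us n)" "combine Ks (us n) = \<zero>" "set Ks \<subseteq> M"
      "set Ks \<noteq> {\<zero>}"
    using dependent_imp_non_trivial_combine[OF M us_carrier] by blast
  \<comment> \<open>The empty list also satisfies \<open>set Ks \<noteq> {\<zero>}\<close>, so this
    case must be excluded before that condition yields a non-zero coefficient.\<close>
  have n: "n \<noteq> 0"
  proof
    assume "n = 0"
    then have "us n = []" by (simp add: us_def)
    then show False using \<open>\<not> independent M (us n)\<close> by (metis li_Nil)
  qed
  have len: "length Ks = n" using Ks(1) by (simp add: us_def)
  have KM: "Ks ! i \<in> M" if "i < n" for i using that len Ks(3) by (auto dest: nth_mem)
  have "combine Ks (us n) = (\<Oplus>i\<in>{..<length (us n)}. Ks ! i \<otimes> us n ! i)"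
    using Ks(1,3) Mc us_carrier by (intro combine_eq_finsum) auto
  also have "\<dots> = (\<Oplus>i\<in>{..<n}. Ks ! i \<otimes> u [^] i)"
    using KM Mc u_pow by (intro finsum_cong') (auto simp: us_def)
  finally have "\<forall>i\<in>{..<n}. Ks ! i = \<zero>"
    using Ks(2) by (intro powers_coefficients_zero[OF dist KM]) auto
  then have "set Ks \<subseteq> {\<zero>}" using len by (auto simp: set_conv_nth)
  moreover have "set Ks \<noteq> {}" using len n by auto
  ultimately show False using Ks(4) subset_singletonD by metis
qed

end

section \<open>Centre, inverses and degree of the generated subalgebra\<close>

text \<open>Together \<open>h\<close>, \<open>s_distinct\<close> and \<open>s_order\<close> say that
  \<open>s\<close> has order exactly \<open>h\<close> on \<open>M\<close>, in terms of iterates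
  rather than of a group.\<close>

locale cyclic_extension = twisted_extension R M s u for R (structure) and M s u +
  fixes h :: nat and n :: nat
  assumes Z: "subfield (ring_center R) R" and ZM: "ring_center R \<subseteq> M"
    and dimR: "dimension (n\<^sup>2) (ring_center R) (carrier R)"
    and dimM: "dimension n (ring_center R) M"
    and s_center: "z \<in> ring_center R \<Longrightarrow> s z = z"
    and h: "0 < h"
    and s_distinct: "i < j \<Longrightarrow> j < h \<Longrightarrow> \<exists>m\<in>M. (s ^^ i) m \<noteq> (s ^^ j) m"
    and s_order: "m \<in> M \<Longrightarrow> (s ^^ h) m = m"
begin

abbreviation "K0 \<equiv> fixed_field L s"
abbreviation "c \<equiv> u [^] h"
abbreviation "B \<equiv> T.ev ` carrier T.P"
abbreviation "D \<equiv> R\<lparr>carrier := B\<rparr>"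

lemma commutant_M_subset: "x \<in> commutant M \<Longrightarrow> x \<in> M"
  using self_centralizing[OF Z M ZM dimR dimM] .

text \<open>Since \<open>u \<otimes> x = s x \<otimes> u\<close>, commuting with \<open>u\<close>
  means \<open>x \<otimes> u = s x \<otimes> u\<close>, and \<open>u\<close> can be
  cancelled.\<close>

lemma fixed_if_commutes:
  assumes "x \<in> M" "x \<otimes> u = u \<otimes> x"
  shows "x \<in> K0"
proof -
  have C: "x \<in> carrier R" "s x \<in> carrier R" using assms(1) s_pow(1)[of x 1] Mc by auto
  have "x \<otimes> u = s x \<otimes> u" using u_twist[OF assms(1)] assms(2) by simp
  then have "(x \<ominus> s x) \<otimes> u = \<zero>"
    using C u_carr by (simp add: minus_eq l_distr l_minus r_neg)
  then have "x \<ominus> s x = \<zero>" using no_zero_div[of "x \<ominus> s x" u] C u_carr u_nz by auto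
  then have "x = s x" using C r_right_minus_eq by blast
  then show ?thesis using assms(1) by (simp add: fixed_field_def)
qed

lemma c_fixed: "c \<in> K0"
proof (rule fixed_if_commutes)
  show "c \<in> M"
    using u_pow_twist s_order u_pow by (intro commutant_M_subset) (auto simp: commutant_def)
  show "c \<otimes> u = u \<otimes> c" using u_carr nat_pow_Suc2[of u h] by simp
qed

lemma c_in_M: "c \<in> M"
  using c_fixed by (simp add: fixed_field_def)

lemma ev_truncated:
  assumes "r \<in> carrier T.P" "\<forall>i\<ge>h. r i = \<zero>"
  shows "T.ev r = (\<Oplus>i\<in>{..<h}. r i \<otimes> u [^] i)"
proof -
  \<comment> \<open>\<open>T.ev_eq_sum\<close> has an inclusive bound; the equation relies on
    \<open>h\<close> being positive.\<close>
  have "{..h - 1} = {..<h}" using h by auto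
  then show ?thesis using T.ev_eq_sum[OF assms(1), of "h - 1"] assms(2) h by simp
qed

lemma P_coeff: "r \<in> carrier T.P \<Longrightarrow> r i \<in> M"
  using T.P_simps(1) by (auto dest: mem_upD)

lemma kernel: "a_kernel T.P R T.ev = cyclic_ideal L s h c"
proof (rule T.kernel_ev[OF h])
  show "c \<in> carrier L" "c = u [^] h" using c_in_M by auto
  fix r assume r: "r \<in> carrier T.P" "\<forall>i\<ge>h. r i = \<zero>\<^bsub>L\<^esub>" "T.ev r = \<zero>"
  then have "\<forall>i\<in>{..<h}. r i = \<zero>"
    using ev_truncated P_coeff by (intro powers_coefficients_zero s_distinct) auto
  then show "r = \<zero>\<^bsub>T.P\<^esub>" using r(2) by (auto simp: T.P_simps(3) not_less[symmetric])
qed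

sublocale E: ring_hom_ring T.P R T.ev by (rule T.ev_ring_hom)

lemma B_sub: "subring B R"
  using E.img_is_subring[OF E.R.carrier_is_subring] .

lemma Bc: "B \<subseteq> carrier R"
  using subringE(1)[OF B_sub] .

lemma M_le_B: "M \<subseteq> B"
proof
  fix m assume m: "m \<in> M"
  then have "T.ev (tw_monom L m 0) = m" using T.ev_monom[of m 0] Mc by auto
  then show "m \<in> B" using T.monom_closed[of m 0] m
    by (intro image_eqI[of _ _ "tw_monom L m 0"]) auto
qed

lemma u_in_B: "u \<in> B"
proof -
  have "T.ev (tw_monom L \<one> 1) = u" using T.ev_monom[of \<one> 1] subringE(3)[OF M_sub] u_carr by auto
  then show ?thesis using T.monom_closed[of \<one> 1] subringE(3)[OF M_sub]
    by (intro image_eqI[of _ _ "tw_monom L \<one> 1"]) auto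
qed

lemma u_pow_in_B: "u [^] (i::nat) \<in> B"
  by (induction i) (use u_in_B subringE(3,6)[OF B_sub] in auto)

text \<open>Multiples of \<open>t^h - c\<close> evaluate to zero, so a preimage may be replaced by
  its remainder, whose value is a combination of the first \<open>h\<close> powers of
  \<open>u\<close>.\<close>

lemma B_eq_Span: "Span M (us h) = B"
proof
  have "subalgebra M B R"
    unfolding subalgebra_def subalgebra_axioms_def
    using subring.axioms(1)[OF B_sub] subringE(6)[OF B_sub] M_le_B by blast
  moreover have "set (us h) \<subseteq> B" using u_pow_in_B by (auto simp: us_def)
  ultimately show "Span M (us h) \<subseteq> B" using subalgebra_Span_incl[OF M] by blast
  show "B \<subseteq> Span M (us h)"
  proof
    fix b assume "b \<in> B"
    then obtain p where p: "p \<in> carrier T.P" "b = T.ev p" by blast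
    let ?f = "tw_monom L \<one>\<^bsub>L\<^esub> h \<ominus>\<^bsub>T.P\<^esub> tw_monom L c 0"
    obtain q r where qr: "q \<in> carrier T.P" "r \<in> carrier T.P" "\<forall>i\<ge>h. r i = \<zero>\<^bsub>L\<^esub>"
      "p = q \<otimes>\<^bsub>T.P\<^esub> ?f \<oplus>\<^bsub>T.P\<^esub> r" using T.division[OF h _ p(1), of c] c_in_M by auto
    have "q \<otimes>\<^bsub>T.P\<^esub> ?f \<in> a_kernel T.P R T.ev"
      unfolding kernel T.cyclic_ideal_eq using qr(1) by blast
    then have "q \<otimes>\<^bsub>T.P\<^esub> ?f \<in> carrier T.P" "T.ev (q \<otimes>\<^bsub>T.P\<^esub> ?f) = \<zero>" unfolding a_kernel_def' by blast+
    then have "b = T.ev r"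
      using p(2) qr(2,4) T.ev_add[of "q \<otimes>\<^bsub>T.P\<^esub> ?f" r] T.ev_closed[OF qr(2)] by simp
    also have "\<dots> = (\<Oplus>i\<in>{..<h}. r i \<otimes> u [^] i)" using ev_truncated qr(2,3) by simp
    also have "\<dots> \<in> Span M (us h)"
      using P_coeff[OF qr(2)] Span_base_incl[OF M us_carrier[of h]]
        Span_smult_closed[OF M us_carrier[of h]]
      by (intro Span_finsum_closed[OF M us_carrier]) (auto simp: us_def subset_eq)
    finally show "b \<in> Span M (us h)" .
  qed
qed

lemma dim_B: "dimension h M B"
  using dimension_independent[OF independent_powers[OF s_distinct, of h]]
  unfolding B_eq_Span length_us .

text \<open>Inside \<open>M\<close>, being fixed by \<open>s\<close> is the same as commuting with
  \<open>u\<close>; closure under negatives and inverses is easiest to see in the second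
  form.\<close>

lemma K0_sub: "subfield K0 R" and ZK0: "ring_center R \<subseteq> K0" and K0M: "K0 \<subseteq> M"
proof -
  show "ring_center R \<subseteq> K0" using ZM s_center by (auto simp: fixed_field_def)
  show K0M: "K0 \<subseteq> M" by (auto simp: fixed_field_def)
  note Ms = subringE[OF M_sub]
  have fx: "x \<in> M" "s x = x" if "x \<in> K0" for x using that by (auto simp: fixed_field_def)
  have fixI: "x \<in> K0" if "x \<in> M" "s x = x" for x using that by (auto simp: fixed_field_def)
  have comm: "x \<otimes> u = u \<otimes> x" if "x \<in> K0" for x using u_twist[of x] fx[OF that] by simp
  show "subfield K0 R"
  proof (rule subfieldI_inv)
    show "subring K0 R"
    proof (rule subringI)
      show "K0 \<subseteq> carrier R" using K0M Mc by blast
      show "\<one> \<in> K0" using Ms(3) s_pow(4)[of 1] by (intro fixI) auto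
      show "\<ominus> x \<in> K0" if "x \<in> K0" for x
        using comm[OF that] fx[OF that] Ms(5) Mc u_carr
        by (intro fixed_if_commutes) (auto simp: l_minus r_minus)
      show "x \<otimes> y \<in> K0" "x \<oplus> y \<in> K0" if "x \<in> K0" "y \<in> K0" for x y
        using fx[OF that(1)] fx[OF that(2)] Ms(6,7) s_pow(2,3)[of x y 1] by (auto intro!: fixI)
    qed
    show "x \<otimes> y = y \<otimes> x" if "x \<in> K0" "y \<in> K0" for x y
      using subfieldE(4)[OF M] fx(1) that by blast
    show "inv x \<in> K0" if "x \<in> K0" "x \<noteq> \<zero>" for x
      using comm[OF that(1)] fx[OF that(1)] that(2) Mc u_carr inv_in_subfield[OF M]
      by (intro fixed_if_commutes inv_commute) auto
  qed
qed

text \<open>A central element of \<open>B\<close> commutes with \<open>M\<close>, so it lies in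
  \<open>M\<close>, and with \<open>u\<close>, so it is fixed. Conversely an element of
  \<open>K0\<close> commutes with the values of monomials, and these generate \<open>B\<close>
  additively.\<close>

lemma center_D: "ring_center D = K0"
proof
  show "ring_center D \<subseteq> K0"
  proof
    fix z assume z: "z \<in> ring_center D"
    then have zB: "z \<in> B" "\<And>b. b \<in> B \<Longrightarrow> z \<otimes> b = b \<otimes> z" by (auto simp: ring_center_def)
    have "z \<in> M" using zB M_le_B Bc by (intro commutant_M_subset) (auto simp: commutant_def)
    then show "z \<in> K0" using zB(2)[OF u_in_B] fixed_if_commutes by blast
  qed
  show "K0 \<subseteq> ring_center D"
  proof
    fix z assume z: "z \<in> K0"
    then have zM: "z \<in> M" "s z = z" by (auto simp: fixed_field_def)
    have zc: "z \<in> carrier R" using zM Mc by auto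
    have "z \<otimes> T.ev p = T.ev p \<otimes> z" if "p \<in> carrier T.P" for p
      using that
    proof (induction rule: T.P_induct)
      case (monom a i)
      then have a: "a \<in> M" "a \<in> carrier R" using Mc by auto
      have "(s ^^ i) z = z" using zM(2) by (induction i) auto
      then have "u [^] i \<otimes> z = z \<otimes> u [^] i" using u_pow_twist[OF zM(1), of i] by simp
      then have "a \<otimes> u [^] i \<otimes> z = a \<otimes> z \<otimes> u [^] i" using a zc u_pow by (simp add: m_assoc)
      also have "a \<otimes> z = z \<otimes> a" using subfieldE(4)[OF M a(1) zM(1)] .
      finally show ?case using T.ev_monom[OF monom] a zc u_pow by (simp add: m_assoc)
    next
      case (add p q)
      then show ?case using zc by (simp add: T.ev_add T.ev_closed l_distr r_distr)
    qed
    then show "z \<in> ring_center D" using zM(1) M_le_B by (auto simp: ring_center_def)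
  qed
qed

lemma B_finite: "finite_dimension (ring_center R) B"
proof -
  have "subalgebra (ring_center R) B R"
    unfolding subalgebra_def subalgebra_axioms_def
    using subring.axioms(1)[OF B_sub] subringE(6)[OF B_sub] M_le_B ZM by blast
  then show ?thesis
    using subalbegra_incl_imp_finite_dimension[OF Z finite_dimensionI[OF dimR] _ Bc] by blast
qed

lemma skewfield_D: "skewfield D"
proof (rule skewfield_subring[OF B_sub])
  show "inv x \<in> B" if "x \<in> B" "x \<noteq> \<zero>" for x
    using inv_in_finite_dimensional_subring[OF B_sub Z _ B_finite that] Bc
    by (auto simp: ring_center_def)
qed

text \<open>If \<open>d < h\<close>, the \<open>d\<close> equations
  \<open>\<Sum> (s ^^ i) k \<otimes> a i = \<zero>\<close>, one for each base element
  \<open>k\<close>, have a non-trivial solution in \<open>M\<close>. The equations are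
  \<open>K0\<close>-linear in \<open>k\<close>, so they hold on all of \<open>M\<close>,
  contradicting the independence of the distinct powers of \<open>s\<close>.\<close>

lemma h_le_degree:
  assumes d: "dimension d K0 M"
  shows "h \<le> d"
proof (rule ccontr)
  assume "\<not> h \<le> d"
  obtain ks where ks: "set ks \<subseteq> carrier R" "independent K0 ks" "length ks = d" "Span K0 ks = M"
    using exists_base[OF K0_sub d] by blast
  have ksM: "set ks \<subseteq> M" using Span_base_incl[OF K0_sub ks(1)] ks(4) by auto
  have "card (set ks) < card {..<h}" using card_length[of ks] ks(3) \<open>\<not> h \<le> d\<close> by auto
  then obtain a where a: "a \<in> {..<h} \<rightarrow> M" "\<exists>i\<in>{..<h}. a i \<noteq> \<zero>"
    and sol: "\<forall>k\<in>set ks. (\<Oplus>i\<in>{..<h}. (s ^^ i) k \<otimes> a i) = \<zero>"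
    using homogeneous_system_nontrivial[OF M_sub inv_in_subfield[OF M],
        of "set ks" "{..<h}" "\<lambda>i k. (s ^^ i) k"] s_pow(1) ksM
    by (auto simp: subset_eq)
  have ac: "a i \<in> M" "a i \<in> carrier R" if "i < h" for i using a(1) that Mc by auto
  have sc: "(s ^^ i) m \<in> carrier R" if "m \<in> M" for i m using s_pow(1)[OF that] Mc by auto
  define V where "V = {m \<in> M. (\<Oplus>i\<in>{..<h}. (s ^^ i) m \<otimes> a i) = \<zero>}"
  have fx: "z \<in> M" "(s ^^ i) z = z" if "z \<in> K0" for z i
    using that by (induction i) (auto simp: fixed_field_def)
  note Ms = subringE[OF M_sub]
  have sm: "z \<otimes> m \<in> V" if z: "z \<in> K0" and m: "m \<in> V" for z m
  proof -
    have zc: "z \<in> carrier R" "m \<in> M" using fx(1)[OF z] m Mc by (auto simp: V_def)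
    have "(\<Oplus>i\<in>{..<h}. (s ^^ i) (z \<otimes> m) \<otimes> a i) = (\<Oplus>i\<in>{..<h}. z \<otimes> ((s ^^ i) m \<otimes> a i))"
      using zc fx[OF z] s_pow(2) ac sc by (intro finsum_cong') (auto simp: m_assoc)
    also have "\<dots> = z \<otimes> (\<Oplus>i\<in>{..<h}. (s ^^ i) m \<otimes> a i)"
      using zc ac sc by (intro finsum_rdistr[symmetric]) auto
    finally show ?thesis using m zc(1) fx(1)[OF z] Ms(6) by (auto simp: V_def)
  qed
  have "subalgebra K0 V R"
  proof (intro subalgebra.intro subalgebra_axioms.intro)
    show "subgroup V (add_monoid R)"
    proof (rule add.subgroupI)
      show Vc: "V \<subseteq> carrier R" using Mc by (auto simp: V_def)
      have K0s: "subring K0 R" using subfieldE(1)[OF K0_sub] .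
      have "(s ^^ i) \<zero> = \<zero>" for i using T.twist_zero[of i] by simp
      then have "(\<Oplus>i\<in>{..<h}. (s ^^ i) \<zero> \<otimes> a i) = \<zero>"
        using ac by (intro add.finprod_one_eqI) auto
      then have "\<zero> \<in> V" using Ms(2) by (simp add: V_def)
      then show "V \<noteq> {}" by blast
      show "\<ominus> m \<in> V" if "m \<in> V" for m
        using sm[OF subringE(5)[OF K0s subringE(3)[OF K0s]] that] Vc that by (auto simp: l_minus)
      show "x \<oplus> y \<in> V" if xy: "x \<in> V" "y \<in> V" for x y
      proof -
        have M: "x \<in> M" "y \<in> M" using xy by (auto simp: V_def)
        have "(\<Oplus>i\<in>{..<h}. (s ^^ i) (x \<oplus> y) \<otimes> a i)
            = (\<Oplus>i\<in>{..<h}. (s ^^ i) x \<otimes> a i \<oplus> (s ^^ i) y \<otimes> a i)"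
          using M s_pow(3) ac sc by (intro finsum_cong') (auto simp: l_distr)
        also have "\<dots> = (\<Oplus>i\<in>{..<h}. (s ^^ i) x \<otimes> a i) \<oplus> (\<Oplus>i\<in>{..<h}. (s ^^ i) y \<otimes> a i)"
          using M ac sc by (intro finsum_addf) auto
        finally show ?thesis using xy Ms(7) by (auto simp: V_def)
      qed
    qed
  qed (rule sm)
  moreover have "set ks \<subseteq> V" using sol ksM by (auto simp: V_def)
  ultimately have "M \<subseteq> V" using subalgebra_Span_incl[OF K0_sub] ks(4) by blast
  have "\<forall>i\<in>{..<h}. a i = \<zero>"
  proof (rule weighted_dedekind[OF M, where s = "\<lambda>i. s ^^ i" and w = "\<lambda>i. \<one>"])
    fix m assume m: "m \<in> M"
    have "(\<Oplus>i\<in>{..<h}. a i \<otimes> (s ^^ i) m \<otimes> \<one>) = (\<Oplus>i\<in>{..<h}. (s ^^ i) m \<otimes> a i)"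
    proof (intro finsum_cong')
      fix i assume i: "i \<in> {..<h}"
      show "a i \<otimes> (s ^^ i) m \<otimes> \<one> = (s ^^ i) m \<otimes> a i"
        using subfieldE(4)[OF M ac(1) s_pow(1)[OF m], of i i] i ac[of i] sc[OF m, of i] by auto
    qed (use ac sc[OF m] in auto)
    then show "(\<Oplus>i\<in>{..<h}. a i \<otimes> (s ^^ i) m \<otimes> \<one>) = \<zero>" using m \<open>M \<subseteq> V\<close> by (auto simp: V_def)
  next
    fix i j assume "i \<in> {..<h}" "j \<in> {..<h}" "i \<noteq> j"
    then show "\<exists>x\<in>M. (s ^^ i) x \<noteq> (s ^^ j) x"
      using s_distinct[of i j] s_distinct[of j i] by (metis lessThan_iff linorder_neqE_nat)
  qed (use ac s_pow one_neq_zero in auto)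
  then show False using a(2) by blast
qed

text \<open>Artin's bound is obtained from the density inequality in the skew field \<open>D\<close>
  instead of \<open>R\<close>: the centre of \<open>D\<close> is \<open>K0\<close>, and
  \<open>h\<close> powers of \<open>u\<close> span \<open>D\<close> over \<open>M\<close>.\<close>

lemma degree_le_h:
  assumes d: "dimension d K0 M"
  shows "d \<le> h"
proof -
  interpret D: skewfield D by (rule skewfield_D)
  obtain ks where ks: "set ks \<subseteq> carrier R" "independent K0 ks" "length ks = d" "Span K0 ks = M"
    using exists_base[OF K0_sub d] by blast
  have ksM: "set ks \<subseteq> M" using Span_base_incl[OF K0_sub ks(1)] ks(4) by auto
  have "length ks \<le> length (us h)"
  proof (rule D.independent_length_le_codimension)
    show "subfield (ring_center D) D"
      unfolding center_D using subfield_consistent[OF B_sub subset_trans[OF K0M M_le_B] K0_sub] .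
    show "subfield M D" using subfield_consistent[OF B_sub M_le_B M] .
    show "D.independent (ring_center D) ks"
      unfolding center_D using independent_consistent[OF B_sub] ks(2) ksM M_le_B by blast
    show "set (us h) \<subseteq> carrier D" using u_pow_in_B by (auto simp: us_def)
    show "D.Span M (us h) = carrier D" using Span_consistent[OF B_sub] B_eq_Span by simp
  qed (rule ksM)
  then show ?thesis using ks(3) by (simp add: us_def)
qed

lemma dim_D: "ring.dimension D (h\<^sup>2) K0 B"
proof -
  have "subalgebra M M R"
    unfolding subalgebra_def subalgebra_axioms_def
    using subring.axioms(1)[OF M_sub] subringE(6)[OF M_sub] by blast
  then have "subalgebra K0 M R" using K0M by (auto simp: subalgebra_def subalgebra_axioms_def)
  then obtain d where d: "dimension d K0 M"
    using finite_dimension_over_larger[OF Z K0_sub ZK0 finite_dimensionI[OF dimM]] by blast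
  then have "d = h" using degree_le_h h_le_degree by (simp add: le_antisym)
  then have "dimension (h\<^sup>2) K0 B"
    using telescopic_base[OF K0_sub M d dim_B] by (simp add: power2_eq_square)
  then show ?thesis using dimension_consistent[OF B_sub subset_refl K0_sub] by blast
qed

lemma has_degree_D: "has_degree K0 D h"
  unfolding has_degree_def carrier_update by (rule dim_D)

lemma central_division_D: "central_division_algebra K0 D"
proof -
  have "subfield K0 D" using subfield_consistent[OF B_sub subset_trans[OF K0M M_le_B] K0_sub] .
  moreover have "ring.finite_dimension D K0 (carrier D)"
    unfolding carrier_update using ring.finite_dimensionI[OF subring_is_ring[OF B_sub] dim_D] .
  ultimately show ?thesis
    unfolding central_division_algebra_def skew_field_iff_skewfield
    by (intro conjI skewfield_D center_D)
qed

end

section \<open>Transport to the quotient algebra\<close>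

lemma central_division_algebra_iso:
  assumes R: "ring R" and S: "ring S" and f: "f \<in> ring_iso R S" and K: "central_division_algebra K R"
  shows "central_division_algebra (f ` K) S"
    and "has_degree K R d \<Longrightarrow> has_degree (f ` K) S d"
proof -
  interpret R: skewfield R
    using K unfolding central_division_algebra_def skew_field_iff_skewfield by blast
  interpret S: ring S by (rule S)
  interpret f: ring_hom_ring R S f
    using f by (intro ring_hom_ringI2[OF R S]) (auto simp: ring_iso_def)
  have bij: "bij_betw f (carrier R) (carrier S)" using f by (simp add: ring_iso_def)
  then have inj: "inj_on f (carrier R)" and img: "f ` carrier R = carrier S"
    by (auto simp: bij_betw_def)
  have Ksub: "subfield K R" and Kcen: "ring_center R = K" and Kfin: "R.finite_dimension K (carrier R)"
    using K by (auto simp: central_division_algebra_def)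
  have nz: "\<one>\<^bsub>S\<^esub> \<noteq> \<zero>\<^bsub>S\<^esub>"
    using inj_onD[OF inj, of "\<one>\<^bsub>R\<^esub>" "\<zero>\<^bsub>R\<^esub>"] R.one_neq_zero by auto
  have dim: "S.dimension m (f ` K) (carrier S)" if "R.dimension m K (carrier R)" for m
    using f.inj_hom_dimension[OF Ksub nz inj that] img by simp
  have "Units S = carrier S - {\<zero>\<^bsub>S\<^esub>}"
  proof (intro equalityI subsetI)
    fix y assume "y \<in> Units S"
    then obtain z where "y \<in> carrier S" "z \<in> carrier S" "y \<otimes>\<^bsub>S\<^esub> z = \<one>\<^bsub>S\<^esub>" by (auto simp: Units_def)
    then show "y \<in> carrier S - {\<zero>\<^bsub>S\<^esub>}" using nz by auto
  next
    fix y assume y: "y \<in> carrier S - {\<zero>\<^bsub>S\<^esub>}"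
    then obtain x where x: "x \<in> carrier R" "y = f x" using img by blast
    then have "x \<noteq> \<zero>\<^bsub>R\<^esub>" using y by auto
    note i = R.inv_props[OF x(1) this]
    have "f x \<otimes>\<^bsub>S\<^esub> f (inv\<^bsub>R\<^esub> x) = \<one>\<^bsub>S\<^esub>" "f (inv\<^bsub>R\<^esub> x) \<otimes>\<^bsub>S\<^esub> f x = \<one>\<^bsub>S\<^esub>"
      using i x(1) f.hom_mult[of x "inv\<^bsub>R\<^esub> x"] f.hom_mult[of "inv\<^bsub>R\<^esub> x" x] by auto
    then show "y \<in> Units S" using x i(1) by (auto simp: Units_def)
  qed
  moreover have "ring_center S = f ` K"
  proof (intro equalityI subsetI)
    fix y assume y: "y \<in> ring_center S"
    then obtain x where x: "x \<in> carrier R" "y = f x" using img by (auto simp: ring_center_def)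
    have "x \<otimes>\<^bsub>R\<^esub> a = a \<otimes>\<^bsub>R\<^esub> x" if a: "a \<in> carrier R" for a
      using y x a by (intro inj_onD[OF inj]) (auto simp: ring_center_def)
    then show "y \<in> f ` K" using x Kcen by (auto simp: ring_center_def)
  next
    fix y assume "y \<in> f ` K"
    then obtain x where x: "x \<in> ring_center R" "y = f x" using Kcen by blast
    have "f x \<otimes>\<^bsub>S\<^esub> b = b \<otimes>\<^bsub>S\<^esub> f x" if b: "b \<in> carrier S" for b
    proof -
      obtain a where a: "a \<in> carrier R" "b = f a" using b img by blast
      then show ?thesis using x(1) f.hom_mult[of x a] f.hom_mult[of a x] by (auto simp: ring_center_def)
    qed
    then show "y \<in> ring_center S" using x by (auto simp: ring_center_def)
  qed
  ultimately show "central_division_algebra (f ` K) S"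
    using S nz f.img_is_subfield(2)[OF Ksub nz] Kfin dim S.finite_dimensionI
    unfolding central_division_algebra_def skew_field_def R.finite_dimension_def by blast
  show "has_degree (f ` K) S d" if "has_degree K R d"
    using that dim by (simp add: has_degree_def)
qed

context cyclic_extension
begin

abbreviation "Q \<equiv> cyclic_algebra L s h c"
abbreviation "\<iota> \<equiv> cyclic_const L s h c"
text \<open>Evaluation is constant on cosets of its kernel, so the image of a coset is a singleton.
  This is the form of the induced map in the first isomorphism theorem.\<close>

abbreviation "\<phi> \<equiv> \<lambda>Y. the_elem (T.ev ` Y)"

text \<open>Two-sidedness needs no computation with \<open>t^h - c\<close>: the left ideal is the
  kernel of a ring homomorphism.\<close>

lemma ideal_cyclic: "ideal (cyclic_ideal L s h c) T.P"
  using E.kernel_is_ideal unfolding kernel .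

lemma phi_iso: "\<phi> \<in> ring_iso Q D"
  using E.FactRing_iso_set_aux unfolding kernel cyclic_algebra_def .

lemma ring_Q: "ring Q"
  using ideal.quotient_is_ring[OF ideal_cyclic] unfolding cyclic_algebra_def .

lemma phi_const:
  assumes "a \<in> M"
  shows "\<iota> a \<in> carrier Q" "\<phi> (\<iota> a) = a"
proof -
  have m: "tw_monom L a 0 \<in> carrier T.P" using T.monom_closed[of a 0] assms by simp
  show "\<iota> a \<in> carrier Q"
    using m by (auto simp: cyclic_const_def cyclic_algebra_def FactRing_def A_RCOSETS_def')
  show "\<phi> (\<iota> a) = a"
    using E.the_elem_simp[OF m] kernel T.ev_monom[of a 0] assms Mc by (auto simp: cyclic_const_def)
qed

lemma cyclic_algebra_central_division:
  "central_division_algebra (\<iota> ` K0) Q" "has_degree (\<iota> ` K0) Q h"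
proof -
  let ?g = "inv_into (carrier Q) \<phi>"
  have g: "?g \<in> ring_iso D Q" using ring_iso_set_sym[OF ring_Q phi_iso] .
  have inj: "inj_on \<phi> (carrier Q)" using phi_iso by (auto simp: ring_iso_def bij_betw_def)
  \<comment> \<open>The base field of the quotient consists of classes of constants, so the inverse
    isomorphism must carry \<open>K0\<close> exactly there.\<close>
  have "?g a = \<iota> a" if "a \<in> K0" for a
    using phi_const[of a] K0M that inv_into_f_eq[OF inj] by blast
  then have "?g ` K0 = \<iota> ` K0" by auto
  moreover have "ring D" using subring_is_ring[OF B_sub] .
  ultimately show "central_division_algebra (\<iota> ` K0) Q" "has_degree (\<iota> ` K0) Q h"
    using central_division_algebra_iso[OF _ ring_Q g central_division_D] has_degree_D by auto
qed

lemma contains_cyclic_algebra: "contains_as_subalgebra (ring_center R) R \<iota> Q"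
  unfolding contains_as_subalgebra_def
proof (intro exI conjI)
  show "subring B R" by (rule B_sub)
  show "ring_center R \<subseteq> B" using ZM M_le_B by blast
  show "\<phi> \<in> ring_iso Q D" by (rule phi_iso)
  show "\<forall>a\<in>ring_center R. \<forall>x\<in>carrier Q. \<phi> (\<iota> a \<otimes>\<^bsub>Q\<^esub> x) = a \<otimes> \<phi> x"
  proof (intro ballI)
    fix a x assume a: "a \<in> ring_center R" and x: "x \<in> carrier Q"
    then show "\<phi> (\<iota> a \<otimes>\<^bsub>Q\<^esub> x) = a \<otimes> \<phi> x"
      using ring_iso_memE(2)[OF phi_iso, of "\<iota> a" x] phi_const[of a] ZM by auto
  qed
qed

end

subsection \<open>Powers of an automorphism\<close>

lemma group_alg_aut_group:
  fixes R (structure)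
  assumes "ring R" "K \<subseteq> carrier R"
  shows "group (alg_aut_group K R)"
proof -
  interpret ring R by (rule assms(1))
  let ?C = "carrier R"
  let ?H = "{\<sigma> \<in> Bij ?C. \<sigma> \<in> ring_hom R R \<and> (\<forall>a\<in>K. \<sigma> a = a)}"
  have "subgroup ?H (BijGroup ?C)"
  proof (rule subgroup.intro)
    show "?H \<subseteq> carrier (BijGroup ?C)" by (auto simp: BijGroup_def)
    show "\<one>\<^bsub>BijGroup ?C\<^esub> \<in> ?H"
      using assms(2) by (auto simp: BijGroup_def id_Bij intro!: ring_hom_memI)
  next
    fix f g assume fg: "f \<in> ?H" "g \<in> ?H"
    then have C: "g x \<in> ?C" if "x \<in> ?C" for x using that ring_hom_memE(1) by fastforce
    have "compose ?C f g \<in> ring_hom R R"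
      using fg C by (intro ring_hom_memI) (auto simp: compose_def ring_hom_def Pi_def)
    moreover have "compose ?C f g \<in> Bij ?C" using fg compose_Bij by blast
    moreover have "f \<otimes>\<^bsub>BijGroup ?C\<^esub> g = compose ?C f g" using fg by (simp add: BijGroup_def)
    ultimately show "f \<otimes>\<^bsub>BijGroup ?C\<^esub> g \<in> ?H"
      using fg assms(2) by (auto simp: compose_def)
  next
    fix f assume f: "f \<in> ?H"
    let ?g = "\<lambda>x\<in>?C. inv_into ?C f x"
    have fB: "f \<in> Bij ?C" and fh: "f \<in> ring_hom R R" using f by auto
    have inj: "inj_on f ?C" using fB by (simp add: Bij_def bij_betw_def)
    have "?g \<in> ring_hom R R"
    proof (rule ring_hom_memI)
      show "?g x \<in> ?C" if "x \<in> ?C" for x using that Bij_inv_into_mem[OF fB] by simp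
      show "?g (x \<otimes> y) = ?g x \<otimes> ?g y" if "x \<in> ?C" "y \<in> ?C" for x y
        using that Bij_inv_into_lemma[of ?C f "(\<otimes>)", OF _ fB] ring_hom_memE(2)[OF fh] by auto
      show "?g (x \<oplus> y) = ?g x \<oplus> ?g y" if "x \<in> ?C" "y \<in> ?C" for x y
        using that Bij_inv_into_lemma[of ?C f "(\<oplus>)", OF _ fB] ring_hom_memE(3)[OF fh] by auto
      show "?g \<one> = \<one>" using inv_into_f_f[OF inj, of \<one>] ring_hom_memE(4)[OF fh] by simp
    qed
    moreover have "?g a = a" if "a \<in> K" for a
      using inv_into_f_f[OF inj, of a] f that assms(2) by auto
    ultimately show "inv\<^bsub>BijGroup ?C\<^esub> f \<in> ?H"
      using inv_BijGroup[OF fB] restrict_inv_into_Bij[OF fB] by simp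
  qed
  then show ?thesis
    unfolding alg_aut_group_def by (rule subgroup.subgroup_is_group[OF _ group_BijGroup])
qed

text \<open>The group composes extensional functions, whereas the twisted product uses plain
  iterates; the two agree after restriction to the carrier.\<close>

lemma alg_aut_group_pow:
  assumes "\<sigma> \<in> carrier (alg_aut_group K R)"
  shows "\<sigma> [^]\<^bsub>alg_aut_group K R\<^esub> (n::nat) = (\<lambda>x\<in>carrier R. (\<sigma> ^^ n) x)"
proof (induction n)
  case 0
  then show ?case by (simp add: alg_aut_group_def BijGroup_def nat_pow_def)
next
  case (Suc n)
  have s: "\<sigma> \<in> Bij (carrier R)" using assms by (simp add: alg_aut_group_def)
  then have C: "\<sigma> x \<in> carrier R" if "x \<in> carrier R" for x using that Bij_imp_funcset by blast
  have "(\<lambda>x\<in>carrier R. (\<sigma> ^^ n) x) \<in> Bij (carrier R)"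
  proof -
    have "bij_betw (\<sigma> ^^ n) (carrier R) (carrier R)"
      using s by (intro bij_betw_funpow) (simp add: Bij_def)
    then show ?thesis by (simp add: Bij_def)
  qed
  then show ?case
    using Suc s C by (auto simp: alg_aut_group_def BijGroup_def nat_pow_def compose_def funpow_swap1 restrict_def)
qed

lemma alg_aut_group_pow_eq_one:
  assumes "\<sigma> \<in> carrier (alg_aut_group K R)"
  shows "\<sigma> [^]\<^bsub>alg_aut_group K R\<^esub> (n::nat) = \<one>\<^bsub>alg_aut_group K R\<^esub> \<longleftrightarrow> (\<forall>x\<in>carrier R. (\<sigma> ^^ n) x = x)"
  unfolding alg_aut_group_pow[OF assms]
  by (auto simp: alg_aut_group_def BijGroup_def restrict_def fun_eq_iff)

text \<open>If the powers \<open>i < j\<close> agreed, cancelling \<open>\<sigma> ^^ i\<close> would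
  make the order divide the positive number \<open>j - i\<close>. Order \<open>0\<close> encodes
  infinite order and divides no positive number, so both cases are settled by the same
  divisibility.\<close>

lemma powers_distinct_below_order:
  assumes "ring R" "K \<subseteq> carrier R" and s: "\<sigma> \<in> carrier (alg_aut_group K R)" and ij: "i < j"
    and h: "group.ord (alg_aut_group K R) \<sigma> = 0 \<or> j < group.ord (alg_aut_group K R) \<sigma>"
  shows "\<exists>x\<in>carrier R. (\<sigma> ^^ i) x \<noteq> (\<sigma> ^^ j) x"
proof (rule ccontr)
  interpret G: group "alg_aut_group K R" using group_alg_aut_group[OF assms(1,2)] .
  assume "\<not> ?thesis"
  then have eq: "(\<sigma> ^^ i) x = (\<sigma> ^^ j) x" if "x \<in> carrier R" for x using that by blast
  have bij: "bij_betw (\<sigma> ^^ k) (carrier R) (carrier R)" for k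
    using s by (intro bij_betw_funpow) (simp add: alg_aut_group_def Bij_def)
  have "(\<sigma> ^^ (j - i)) x = x" if x: "x \<in> carrier R" for x
  proof (rule inj_onD[OF bij_betw_imp_inj_on[OF bij]])
    have "(\<sigma> ^^ i) ((\<sigma> ^^ (j - i)) x) = (\<sigma> ^^ (i + (j - i))) x" by (simp only: funpow_add o_apply)
    also have "\<dots> = (\<sigma> ^^ i) x" using eq[OF x] ij by simp
    finally show "(\<sigma> ^^ i) ((\<sigma> ^^ (j - i)) x) = (\<sigma> ^^ i) x" .
    show "(\<sigma> ^^ (j - i)) x \<in> carrier R" using bij_betwE[OF bij] x by blast
  qed (rule x)
  then have "G.ord \<sigma> dvd j - i"
    using G.pow_eq_id[OF s, of "j - i"] alg_aut_group_pow_eq_one[OF s] by blast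
  then show False using ij h dvd_imp_le[of "G.ord \<sigma>" "j - i"] by auto
qed

section \<open>Assembly of the result\<close>

theorem theorem4:
  fixes A :: "('a, 'b) ring_scheme" and F M :: "'a set" and \<sigma> :: "'a \<Rightarrow> 'a" and h :: nat
  defines "L \<equiv> A\<lparr>carrier := M\<rparr>"
  assumes "central_division_algebra F A"
    and "maximal_subfield F A M"
    and "\<sigma> \<in> carrier (alg_aut_group F L)"
    and "\<sigma> \<noteq> \<one>\<^bsub>alg_aut_group F L\<^esub>"
    and "h = group.ord (alg_aut_group F L) \<sigma>"
  shows "\<exists>c \<in> fixed_field L \<sigma> - {\<zero>\<^bsub>A\<^esub>}.
    ideal (cyclic_ideal L \<sigma> h c) (twisted_poly_ring L \<sigma>) \<and>
    central_division_algebra (cyclic_const L \<sigma> h c ` fixed_field L \<sigma>) (cyclic_algebra L \<sigma> h c) \<and>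
    has_degree (cyclic_const L \<sigma> h c ` fixed_field L \<sigma>) (cyclic_algebra L \<sigma> h c) h \<and>
    contains_as_subalgebra F A (cyclic_const L \<sigma> h c) (cyclic_algebra L \<sigma> h c)"
proof -
  have skew: "skewfield A" and FA: "subfield F A" and cen: "ring_center A = F"
    using assms(2) unfolding central_division_algebra_def skew_field_iff_skewfield by blast+
  interpret A: skewfield A by (rule skew)
  obtain n where M: "subfield M A" "F \<subseteq> M"
    and n: "A.dimension (n\<^sup>2) F (carrier A)" "A.dimension n F M"
    using assms(3) unfolding maximal_subfield_def has_degree_def by blast
  have Msub: "subring M A" and Mc: "M \<subseteq> carrier A" using subfieldE(1,3)[OF M(1)] by auto
  have cL: "carrier L = M" by (simp add: L_def)
  have ringL: "ring L" unfolding L_def using A.subring_is_ring[OF Msub] .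
  have FL: "F \<subseteq> carrier L" using M(2) cL by simp
  have s: "\<sigma> \<in> ring_hom L L" and sF: "\<And>z. z \<in> F \<Longrightarrow> \<sigma> z = z"
    using assms(4) by (auto simp: alg_aut_group_def)
  have sM: "\<sigma> x \<in> M" "\<sigma> (x \<otimes>\<^bsub>A\<^esub> y) = \<sigma> x \<otimes>\<^bsub>A\<^esub> \<sigma> y" "\<sigma> (x \<oplus>\<^bsub>A\<^esub> y) = \<sigma> x \<oplus>\<^bsub>A\<^esub> \<sigma> y" "\<sigma> \<one>\<^bsub>A\<^esub> = \<one>\<^bsub>A\<^esub>"
    if "x \<in> M" "y \<in> M" for x y
    using that ring_hom_memE[OF s] by (auto simp: L_def)
  have "\<exists>u\<in>carrier A - {\<zero>\<^bsub>A\<^esub>}. \<forall>m\<in>M. u \<otimes>\<^bsub>A\<^esub> m = \<sigma> m \<otimes>\<^bsub>A\<^esub> u"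
  proof (rule A.skolem_noether_subfield[OF _ Msub])
    show "subfield (ring_center A) A" "A.dimension n (ring_center A) M" using FA n cen by auto
    show "\<sigma> \<one>\<^bsub>A\<^esub> = \<one>\<^bsub>A\<^esub>" using sM(4) subringE(3)[OF Msub] by blast
    show "z \<in> M \<and> \<sigma> z = z" if "z \<in> ring_center A" for z using that cen M(2) sF by auto
  qed (use sM Mc in auto)
  then obtain u where u: "u \<in> carrier A" "u \<noteq> \<zero>\<^bsub>A\<^esub>" "\<And>m. m \<in> M \<Longrightarrow> u \<otimes>\<^bsub>A\<^esub> m = \<sigma> m \<otimes>\<^bsub>A\<^esub> u"
    by blast
  interpret E: twisted_extension A M \<sigma> u
    using M(1) s u unfolding L_def
    by (intro twisted_extension.intro twisted_extension_axioms.intro skew)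
  have dist: "\<exists>m\<in>M. (\<sigma> ^^ i) m \<noteq> (\<sigma> ^^ j) m" if "i < j" "h = 0 \<or> j < h" for i j
    using powers_distinct_below_order[OF ringL FL assms(4) that(1)] that(2) assms(6) cL by auto
  \<comment> \<open>For \<open>h = 0\<close> all powers of \<open>\<sigma>\<close> would be
    distinct, hence arbitrarily many powers of \<open>u\<close> independent over \<open>M\<close>;
    but \<open>A\<close> has finite dimension \<open>r\<close> over \<open>M\<close>, and
    \<open>Suc r\<close> powers are already too many.\<close>
  have h: "0 < h"
  proof (rule ccontr)
    assume "\<not> 0 < h"
    then have ind: "A.independent M (E.us k)" for k
      by (intro E.independent_powers dist) auto
    obtain r where r: "A.dimension r M (carrier A)"
      using A.finite_dimension_over_larger[OF FA M(1,2) A.finite_dimensionI[OF n(1)]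
          A.carrier_is_subalgebra[OF Mc]] by blast
    show False
      using A.independent_length_le_dimension[OF M(1) r ind E.us_carrier, of "Suc r"] E.length_us[of "Suc r"]
      by simp
  qed
  have order: "(\<sigma> ^^ h) m = m" if "m \<in> M" for m
  proof -
    interpret G: group "alg_aut_group F L" using group_alg_aut_group[OF ringL FL] .
    show ?thesis
      using G.pow_ord_eq_1[OF assms(4)] alg_aut_group_pow_eq_one[OF assms(4), of h] assms(6) that cL
      by auto
  qed
  interpret C: cyclic_extension A M \<sigma> u h n
    using FA M(2) n sF h order dist unfolding cen[symmetric]
    by (intro cyclic_extension.intro cyclic_extension_axioms.intro E.twisted_extension_axioms) auto
  note cyclic = C.ideal_cyclic C.cyclic_algebra_central_division C.contains_cyclic_algebra
  show ?thesis
    unfolding L_def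
    using C.c_fixed E.u_pow(2)[of h] cyclic[unfolded cen]
    by (intro bexI[of _ "u [^]\<^bsub>A\<^esub> h"] conjI) auto
qed

end
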